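(* Let $G$ be a finite group. Let $f,g:G\to G$ be modelled as random oracles (independent, uniformly random functions) and let the subkeys of $k=(k^L,k^R)\in G^2$ be chosen independently and uniformly at random. Let $\Psi=\Psi_k^{f,g}$ be the permutation of $G^2$ given by $\Psi_k^{f,g}(x)=\mathcal{F}_{g,f,f,g}(x\cdot k)\cdot k$, and let $R$ be a uniformly random permutation of $G^2$. Then, for any probabilistic $4$-oracle adversary $\mathcal{A}$ with at most $q_c$ queries to $\Psi$ and $\Psi^{-1}$ (or $R$ and $R^{-1}$) in total, $q_f$ queries to $f$, and $q_g$ queries to $g$, we have $$\left| \Pr\left[ \mathcal{A}^{\Psi,\Psi^{-1},f,g} = 1\right] - \Pr\left[ \mathcal{A}^{R,R^{-1},f,g} = 1\right] \right| \leq (2q_c^2 +4q_fq_c + 4q_gq_c + q_c^2 - q_c)|G|^{-1} + 2\binom{q_c}{2}\left(2|G|^{-1} + |G|^{-2}\right).$$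
   Context: $G$ is not necessarily abelian. For $\phi:G\to G$ let $\mathcal{F}_\phi:G\times G\to G\times G$, $(x,y)\mapsto (y,x\cdot \phi(y))$ (one Group Feistel round), and $\mathcal{F}_{\phi_1,\phi_2,\phi_3,\phi_4}=\mathcal{F}_{\phi_4}\circ\mathcal{F}_{\phi_3}\circ\mathcal{F}_{\phi_2}\circ\mathcal{F}_{\phi_1}$. For $x=(x^L,x^R)$, $k=(k^L,k^R)\in G^2$, $x\cdot k=(x^L\cdot k^L,x^R\cdot k^R)$. The adversary is an adaptive, computationally unbounded oracle algorithm outputting a bit. The probabilities are over $f,g,k$ (respectively $f,g,R$, with $R$ independent of $f,g$) and the coins of $\mathcal{A}$. *)

theory Defs
  imports "HOL-Probability.Probability" "HOL-Algebra.Algebra" "HOL-Combinatorics.Permutations"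
begin

definition feistel :: "('a, 'b) monoid_scheme \<Rightarrow> ('a \<Rightarrow> 'a) \<Rightarrow> 'a \<times> 'a \<Rightarrow> 'a \<times> 'a" where
  "feistel G \<phi> = (\<lambda>(x, y). (y, x \<otimes>\<^bsub>G\<^esub> \<phi> y))"

definition feistel4 ::
  "('a, 'b) monoid_scheme \<Rightarrow> ('a \<Rightarrow> 'a) \<Rightarrow> ('a \<Rightarrow> 'a) \<Rightarrow> ('a \<Rightarrow> 'a) \<Rightarrow> ('a \<Rightarrow> 'a) \<Rightarrow> 'a \<times> 'a \<Rightarrow> 'a \<times> 'a"
  where "feistel4 G \<phi>1 \<phi>2 \<phi>3 \<phi>4 = feistel G \<phi>4 \<circ> feistel G \<phi>3 \<circ> feistel G \<phi>2 \<circ> feistel G \<phi>1"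

definition cipher ::
  "('a, 'b) monoid_scheme \<Rightarrow> ('a \<Rightarrow> 'a) \<Rightarrow> ('a \<Rightarrow> 'a) \<Rightarrow> 'a \<times> 'a \<Rightarrow> 'a \<times> 'a \<Rightarrow> 'a \<times> 'a" where
  "cipher G f g k x = feistel4 G g f f g (x \<otimes>\<^bsub>G \<times>\<times> G\<^esub> k) \<otimes>\<^bsub>G \<times>\<times> G\<^esub> k"

text \<open>
  An adversary is a strategy tree: at each node it stops with an output bit, tosses coins
  (with an arbitrary discrete distribution), or queries one of the four oracles and continues
  depending on the answer. Since the continuation is an arbitrary function of everything seen so
  far, the adversary is adaptive and computationally unbounded.
\<close>
datatype 'a adversary =
    Output bool
  | Toss "nat pmf" "nat \<Rightarrow> 'a adversary"
  | Query_fwd "'a \<times> 'a" "'a \<times> 'a \<Rightarrow> 'a adversary"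
  | Query_bwd "'a \<times> 'a" "'a \<times> 'a \<Rightarrow> 'a adversary"
  | Query_f 'a "'a \<Rightarrow> 'a adversary"
  | Query_g 'a "'a \<Rightarrow> 'a adversary"

primrec run ::
  "('a \<times> 'a \<Rightarrow> 'a \<times> 'a) \<Rightarrow> ('a \<times> 'a \<Rightarrow> 'a \<times> 'a) \<Rightarrow> ('a \<Rightarrow> 'a) \<Rightarrow> ('a \<Rightarrow> 'a) \<Rightarrow> 'a adversary \<Rightarrow> bool pmf"
  where
    "run P Q f g (Output b) = return_pmf b"
  | "run P Q f g (Toss p K) = bind_pmf p (\<lambda>n. run P Q f g (K n))"
  | "run P Q f g (Query_fwd x K) = run P Q f g (K (P x))"
  | "run P Q f g (Query_bwd y K) = run P Q f g (K (Q y))"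
  | "run P Q f g (Query_f u K) = run P Q f g (K (f u))"
  | "run P Q f g (Query_g u K) = run P Q f g (K (g u))"

text \<open>
  With the given oracles, every run (every possible outcome of the coins) queries only points of
  the domains of the oracles, with at most \<open>qc\<close> queries to \<open>P\<close> and \<open>Q\<close> together,
  \<open>qf\<close> to \<open>f\<close> and \<open>qg\<close> to \<open>g\<close>.
\<close>
primrec run_bounded ::
  "('a, 'b) monoid_scheme \<Rightarrow> ('a \<times> 'a \<Rightarrow> 'a \<times> 'a) \<Rightarrow> ('a \<times> 'a \<Rightarrow> 'a \<times> 'a) \<Rightarrow> ('a \<Rightarrow> 'a) \<Rightarrow> ('a \<Rightarrow> 'a) \<Rightarrow>
    'a adversary \<Rightarrow> nat \<Rightarrow> nat \<Rightarrow> nat \<Rightarrow> bool"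
  where
    "run_bounded G P Q f g (Output b) qc qf qg \<longleftrightarrow> True"
  | "run_bounded G P Q f g (Toss p K) qc qf qg \<longleftrightarrow>
       (\<forall>n\<in>set_pmf p. run_bounded G P Q f g (K n) qc qf qg)"
  | "run_bounded G P Q f g (Query_fwd x K) qc qf qg \<longleftrightarrow>
       x \<in> carrier (G \<times>\<times> G) \<and> qc > 0 \<and> run_bounded G P Q f g (K (P x)) (qc - 1) qf qg"
  | "run_bounded G P Q f g (Query_bwd y K) qc qf qg \<longleftrightarrow>
       y \<in> carrier (G \<times>\<times> G) \<and> qc > 0 \<and> run_bounded G P Q f g (K (Q y)) (qc - 1) qf qg"
  | "run_bounded G P Q f g (Query_f u K) qc qf qg \<longleftrightarrow>
       u \<in> carrier G \<and> qf > 0 \<and> run_bounded G P Q f g (K (f u)) qc (qf - 1) qg"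
  | "run_bounded G P Q f g (Query_g u K) qc qf qg \<longleftrightarrow>
       u \<in> carrier G \<and> qg > 0 \<and> run_bounded G P Q f g (K (g u)) qc qf (qg - 1)"

definition query_bounded ::
  "('a, 'b) monoid_scheme \<Rightarrow> 'a adversary \<Rightarrow> nat \<Rightarrow> nat \<Rightarrow> nat \<Rightarrow> bool" where
  "query_bounded G A qc qf qg \<longleftrightarrow>
     (\<forall>P f g. bij_betw P (carrier (G \<times>\<times> G)) (carrier (G \<times>\<times> G)) \<longrightarrow>
        f \<in> carrier G \<rightarrow> carrier G \<longrightarrow> g \<in> carrier G \<rightarrow> carrier G \<longrightarrow>
        run_bounded G P (inv_into (carrier (G \<times>\<times> G)) P) f g A qc qf qg)"

definition random_oracle :: "('a, 'b) monoid_scheme \<Rightarrow> ('a \<Rightarrow> 'a) pmf" where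
  "random_oracle G = pmf_of_set (carrier G \<rightarrow>\<^sub>E carrier G)"

definition real_game :: "('a, 'b) monoid_scheme \<Rightarrow> 'a adversary \<Rightarrow> bool pmf" where
  "real_game G A =
     do {
       f \<leftarrow> random_oracle G;
       g \<leftarrow> random_oracle G;
       k \<leftarrow> pmf_of_set (carrier (G \<times>\<times> G));
       run (cipher G f g k) (inv_into (carrier (G \<times>\<times> G)) (cipher G f g k)) f g A
     }"

definition ideal_game :: "('a, 'b) monoid_scheme \<Rightarrow> 'a adversary \<Rightarrow> bool pmf" where
  "ideal_game G A =
     do {
       f \<leftarrow> random_oracle G;
       g \<leftarrow> random_oracle G;
       R \<leftarrow> pmf_of_set {\<pi>. \<pi> permutes carrier (G \<times>\<times> G)};
       run R (inv_into (carrier (G \<times>\<times> G)) R) f g A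
     }"

lemma (in group) bij_betw_feistel:
  assumes "\<phi> \<in> carrier G \<rightarrow> carrier G"
  shows "bij_betw (feistel G \<phi>) (carrier (G \<times>\<times> G)) (carrier (G \<times>\<times> G))"
  by (rule bij_betw_byWitness[where f' = "\<lambda>(u, v). (v \<otimes> inv (\<phi> u), u)"])
    (use assms in \<open>auto simp: feistel_def m_assoc Pi_iff\<close>)

lemma (in group) bij_betw_cipher:
  assumes "f \<in> carrier G \<rightarrow> carrier G" "g \<in> carrier G \<rightarrow> carrier G" "k \<in> carrier (G \<times>\<times> G)"
  shows "bij_betw (cipher G f g k) (carrier (G \<times>\<times> G)) (carrier (G \<times>\<times> G))"
proof -
  let ?S = "carrier (G \<times>\<times> G)"
  obtain kl kr where k: "k = (kl, kr)" "kl \<in> carrier G" "kr \<in> carrier G"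
    using assms(3) by auto
  have mul: "bij_betw (\<lambda>x. x \<otimes>\<^bsub>G \<times>\<times> G\<^esub> k) ?S ?S"
    by (rule bij_betw_byWitness[where f' = "\<lambda>(u, v). (u \<otimes> inv kl, v \<otimes> inv kr)"])
      (use k in \<open>auto simp: m_assoc\<close>)
  have "cipher G f g k = (\<lambda>x. x \<otimes>\<^bsub>G \<times>\<times> G\<^esub> k) \<circ> (feistel G g \<circ> (feistel G f \<circ>
          (feistel G f \<circ> (feistel G g \<circ> (\<lambda>x. x \<otimes>\<^bsub>G \<times>\<times> G\<^esub> k)))))"
    by (auto simp: cipher_def feistel4_def)
  then show ?thesis
    using mul bij_betw_feistel[OF assms(1)] bij_betw_feistel[OF assms(2)]
    by (auto intro!: bij_betw_trans)
qed

end

theory Submission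
  imports Defs
begin

text \<open>
  One-sided H-coefficient argument. Fix a transcript: \<open>m \<le> q\<^sub>c\<close> plaintext-ciphertext pairs together with
  the queried values of \<open>f\<close> and \<open>g\<close>. Given the key and \<open>g\<close>, each pair determines two inputs of
  \<open>f\<close> and the values that \<open>f\<close> must take there. Unless one of a short list of coincidences happens,
  each of probability at most \<open>1 / N\<close> with \<open>N = |G|\<close>, these are \<open>2 m\<close> distinct fresh inputs, so that a
  random \<open>f\<close> fits with probability \<open>N\<^sup>-\<^sup>2\<^sup>m\<close>, whereas a random permutation fits with
  probability \<open>(N\<^sup>2 - m)! / (N\<^sup>2)!\<close>. Hence every transcript is at least \<open>1 - \<delta>\<close> times as likely
  in the real game as in the ideal one. Since there are no bad transcripts, both outputs of the
  adversary inherit this ratio, and the advantage is at most \<open>\<delta>\<close>.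
\<close>

section \<open>Counting the functions and permutations that extend a transcript\<close>

text \<open>Relations rather than query lists record the transcript: a repeated query adds nothing,
  and forward and backward queries produce the same kind of pair.\<close>

definition agrees :: "('c \<Rightarrow> 'd) \<Rightarrow> ('c \<times> 'd) set \<Rightarrow> bool" where
  "agrees h M \<longleftrightarrow> (\<forall>x y. (x, y) \<in> M \<longrightarrow> h x = y)"

lemma agrees_simps [simp]:
  "agrees h {}"
  "agrees h (insert (x, y) M) \<longleftrightarrow> h x = y \<and> agrees h M"
  "agrees h (M \<union> N) \<longleftrightarrow> agrees h M \<and> agrees h N"
  by (auto simp: agrees_def)

lemma agreesD: "agrees h M \<Longrightarrow> (x, y) \<in> M \<Longrightarrow> h x = y"
  by (auto simp: agrees_def)

lemma agrees_single_valued: "agrees h M \<Longrightarrow> single_valued M"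
  unfolding agrees_def single_valued_def by blast

lemma card_Domain_single_valued:
  assumes "single_valued M"
  shows "card (Domain M) = card M"
proof -
  have "inj_on fst M"
    using assms by (auto simp: inj_on_def single_valued_def)
  then show ?thesis
    by (metis Domain_fst card_image)
qed

text \<open>Each pair of \<open>F\<close> pins one argument and the remaining ones are free: the set
  is a product of sets \<open>B u\<close>, singletons on \<open>Domain F\<close> and all of
  \<open>C\<close> elsewhere.\<close>

lemma card_funcset_agrees:
  assumes C: "finite C" and F: "F \<subseteq> C \<times> C" "single_valued F"
  shows "card {f \<in> C \<rightarrow>\<^sub>E C. agrees f F} = card C ^ (card C - card F)"
proof -
  define B where "B u = (if u \<in> Domain F then F `` {u} else C)" for u
  have one: "\<exists>v. F `` {u} = {v}" if "u \<in> Domain F" for u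
    using that F(2) by (auto simp: single_valued_def)
  have "{f \<in> C \<rightarrow>\<^sub>E C. agrees f F} = PiE C B"
  proof (intro equalityI subsetI)
    fix f assume f: "f \<in> {f \<in> C \<rightarrow>\<^sub>E C. agrees f F}"
    then show "f \<in> PiE C B"
      by (auto simp: B_def PiE_iff agrees_def)
  next
    fix f assume f: "f \<in> PiE C B"
    have "f u = v" if "(u, v) \<in> F" for u v
    proof -
      have "u \<in> C" "u \<in> Domain F" using that F(1) by auto
      then have "f u \<in> F `` {u}"
        using f by (metis PiE_mem B_def)
      then show ?thesis using that F(2) by (auto simp: single_valued_def)
    qed
    moreover have "f u \<in> C" if "u \<in> C" for u
    proof -
      have "f u \<in> B u" using f that by auto
      then show ?thesis using F(1) by (auto simp: B_def split: if_splits)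
    qed
    ultimately show "f \<in> {f \<in> C \<rightarrow>\<^sub>E C. agrees f F}"
      using f by (auto simp: agrees_def PiE_iff)
  qed
  then have "card {f \<in> C \<rightarrow>\<^sub>E C. agrees f F} = (\<Prod>u\<in>C. card (B u))"
    using C by (simp add: card_PiE)
  also have "\<dots> = (\<Prod>u\<in>C. if u \<in> Domain F then 1 else card C)"
    by (intro prod.cong refl) (use one in \<open>force simp: B_def\<close>)
  also have "\<dots> = card C ^ card (C - Domain F)"
    using C by (simp add: prod.If_cases Diff_eq)
  also have "card (C - Domain F) = card C - card F"
  proof -
    have "Domain F \<subseteq> C" using F(1) by auto
    then show ?thesis
      by (simp add: card_Diff_subset finite_subset[OF _ C] card_Domain_single_valued[OF F(2)])
  qed
  finally show ?thesis .
qed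

text \<open>Composition with the inverse of one fixed solution \<open>R0\<close> turns every
  solution into a permutation that fixes \<open>Domain M\<close> pointwise, and this is injective.
  An upper bound suffices, because the count is used on the ideal side only.\<close>

lemma card_permutes_agrees_le:
  assumes S: "finite S" and M: "M \<subseteq> S \<times> S"
  shows "card {R. R permutes S \<and> agrees R M} \<le> fact (card S - card M)"
proof (cases "{R. R permutes S \<and> agrees R M} = {}")
  case False
  then obtain R0 where R0: "R0 permutes S" "agrees R0 M" by auto
  have "inv_into UNIV R0 \<circ> R permutes S - Domain M" if R: "R permutes S" "agrees R M" for R
  proof (rule permutes_superset)
    show "inv_into UNIV R0 \<circ> R permutes S"
      using R(1) R0(1) by (intro permutes_compose permutes_inv)
    fix x assume "x \<in> S - (S - Domain M)"
    then obtain y where "(x, y) \<in> M" by auto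
    then have "R x = R0 x" using agreesD[OF R(2)] agreesD[OF R0(2)] by metis
    then show "(inv_into UNIV R0 \<circ> R) x = x"
      using permutes_inj[OF R0(1)] by simp
  qed
  moreover have "inj_on ((\<circ>) (inv_into UNIV R0)) {R. R permutes S \<and> agrees R M}"
  proof (rule inj_onI)
    fix R R' assume "inv_into UNIV R0 \<circ> R = inv_into UNIV R0 \<circ> R'"
    then have "R0 \<circ> inv_into UNIV R0 \<circ> R = R0 \<circ> inv_into UNIV R0 \<circ> R'"
      by (simp add: comp_assoc)
    then show "R = R'"
      by (simp add: permutes_inv_o[OF R0(1)])
  qed
  ultimately have "card {R. R permutes S \<and> agrees R M} \<le> card {p. p permutes S - Domain M}"
    by (intro card_inj_on_le[where f = "(\<circ>) (inv_into UNIV R0)"]) (auto simp: S finite_permutations)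
  also have "\<dots> = fact (card S - card M)"
  proof -
    have "Domain M \<subseteq> S" using M by auto
    then have "card (S - Domain M) = card S - card M"
      using card_Domain_single_valued[OF agrees_single_valued[OF R0(2)]]
      by (simp add: card_Diff_subset finite_subset[OF _ S])
    then show ?thesis using S by (simp add: card_permutations)
  qed
  finally show ?thesis .
next
  case True
  then show ?thesis by (metis card.empty zero_le)
qed

text \<open>Birthday bound: dividing \<open>fact n / fact (n - m)\<close> by \<open>n ^ m\<close>
  leaves the factors \<open>1 - j / n\<close> with \<open>j < m\<close>, whose product is at least
  one minus the sum of the \<open>j / n\<close>. It is applied with \<open>n\<close> the number of
  plaintexts.\<close>

lemma power_times_fact_ge:
  assumes "m \<le> n"
  shows "(1 - real (m choose 2) / real n) * (real n ^ m * fact (n - m)) \<le> fact n"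
  using assms
proof (induction m)
  case (Suc m)
  have n: "real n > 0" "m \<le> n" using Suc.prems by auto
  have ch: "real (Suc m choose 2) = real (m choose 2) + real m"
    by (simp add: numeral_2_eq_2)
  have nm: "fact (n - m) = real (n - m) * fact (n - Suc m)"
    using Suc.prems by (metis Suc_diff_Suc Suc_le_lessD fact_Suc of_nat_mult of_nat_fact)
  define a b where "a = real (m choose 2) / n" and "b = real m / n"
  have ab: "0 \<le> a" "0 \<le> b" "b \<le> 1" using n by (auto simp: a_def b_def)
  have "1 - real (Suc m choose 2) / n = 1 - a - b"
    by (simp add: ch a_def b_def add_divide_distrib)
  also have "\<dots> \<le> (1 - a) * (1 - b)"
    using mult_nonneg_nonneg[OF ab(1,2)] by (simp add: algebra_simps)
  finally have "(1 - real (Suc m choose 2) / n) * (real n ^ Suc m * fact (n - Suc m))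
      \<le> (1 - a) * (1 - b) * (real n ^ Suc m * fact (n - Suc m))"
    by (intro mult_right_mono) auto
  also have "\<dots> = (1 - a) * (real n ^ m * ((1 - b) * n * fact (n - Suc m)))"
    by (simp add: algebra_simps)
  also have "(1 - b) * n = real (n - m)"
    using n by (simp add: b_def field_simps of_nat_diff)
  also have "(1 - a) * (real n ^ m * (real (n - m) * fact (n - Suc m))) \<le> fact n"
    using Suc.IH n by (simp add: nm a_def)
  finally show ?case .
qed simp

text \<open>The source of every bound of the form \<open>1 / N\<close>: if overwriting a component
  of a bad world by \<open>v\<close> is injective in the world and \<open>v\<close> together, then
  \<open>B\<close> fills at most a fraction \<open>1 / card C\<close> of \<open>T\<close>.\<close>

lemma card_mult_le_via_inj:
  assumes T: "finite T" and B: "B \<subseteq> T"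
    and maps: "\<And>v w. v \<in> C \<Longrightarrow> w \<in> B \<Longrightarrow> upd v w \<in> T"
    and inj: "\<And>v w v' w'. \<lbrakk>v \<in> C; w \<in> B; v' \<in> C; w' \<in> B; upd v w = upd v' w'\<rbrakk> \<Longrightarrow> v = v' \<and> w = w'"
  shows "card C * card B \<le> card T"
proof -
  have "card (C \<times> B) \<le> card T"
    by (rule card_inj_on_le[where f = "\<lambda>(v, w). upd v w"])
      (use T maps in \<open>auto intro!: inj_onI dest: inj\<close>)
  then show ?thesis by (simp add: card_cartesian_product)
qed

section \<open>From transcripts to output probabilities of a strategy tree\<close>

lemma sum_fibres:
  fixes h :: "'y \<Rightarrow> 'w \<Rightarrow> 'c :: comm_monoid_add"
  assumes "finite T" "finite Y" "\<And>w. w \<in> T \<Longrightarrow> \<phi> w \<in> Y"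
  shows "(\<Sum>y\<in>Y. \<Sum>w | w \<in> T \<and> \<phi> w = y. h y w) = (\<Sum>w\<in>T. h (\<phi> w) w)"
proof -
  have "(\<Sum>w\<in>T. h (\<phi> w) w) = (\<Sum>y\<in>Y. \<Sum>w | w \<in> T \<and> \<phi> w = y. h (\<phi> w) w)"
    using assms by (intro sum.group[symmetric]) auto
  also have "\<dots> = (\<Sum>y\<in>Y. \<Sum>w | w \<in> T \<and> \<phi> w = y. h y w)"
    by (intro sum.cong) auto
  finally show ?thesis by simp
qed

text \<open>Both sums are split by the answer \<open>y\<close> of an oracle, so a comparison for
  each answer adds up to one of the whole sums.\<close>

lemma sum_fibres_le:
  fixes hu :: "'y \<Rightarrow> 'u \<Rightarrow> real" and hv :: "'y \<Rightarrow> 'v \<Rightarrow> real"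
  assumes "finite T1" "finite T2" "finite Y"
    and "\<And>w. w \<in> T1 \<Longrightarrow> \<phi>u w \<in> Y" "\<And>w. w \<in> T2 \<Longrightarrow> \<phi>v w \<in> Y"
    and "\<And>y. y \<in> Y \<Longrightarrow> c2 * (\<Sum>w | w \<in> T2 \<and> \<phi>v w = y. hv y w) \<le> c1 * (\<Sum>w | w \<in> T1 \<and> \<phi>u w = y. hu y w)"
  shows "c2 * (\<Sum>w\<in>T2. hv (\<phi>v w) w) \<le> c1 * (\<Sum>w\<in>T1. hu (\<phi>u w) w)"
proof -
  have "c2 * (\<Sum>w\<in>T2. hv (\<phi>v w) w) = (\<Sum>y\<in>Y. c2 * (\<Sum>w | w \<in> T2 \<and> \<phi>v w = y. hv y w))"
    by (simp add: sum_fibres[OF assms(2,3,5)] sum_distrib_left[symmetric])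
  also have "\<dots> \<le> (\<Sum>y\<in>Y. c1 * (\<Sum>w | w \<in> T1 \<and> \<phi>u w = y. hu y w))"
    by (intro sum_mono assms(6))
  also have "\<dots> = c1 * (\<Sum>w\<in>T1. hu (\<phi>u w) w)"
    by (simp add: sum_fibres[OF assms(1,3,4)] sum_distrib_left[symmetric])
  finally show ?thesis .
qed

text \<open>Induction over the strategy tree, for all transcripts and all remaining budgets
  \<open>nc\<close>, \<open>nf\<close>, \<open>ng\<close>. \<open>T1\<close> and \<open>T2\<close>
  collect the worlds still consistent with the transcript; a query splits them by its answer, and at
  a leaf with bit \<open>b\<close> the claim is the assumed comparison of cardinalities. Worlds are
  abstract so that the real and the ideal game are treated alike. No sign is imposed on
  \<open>c2\<close>.\<close>

lemma sum_transcript_le: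
  fixes G :: "('a, 'b) monoid_scheme" and c1 c2 :: real
    and P1 :: "'u \<Rightarrow> 'a \<times> 'a \<Rightarrow> 'a \<times> 'a" and f1 g1 :: "'u \<Rightarrow> 'a \<Rightarrow> 'a"
    and P2 :: "'v \<Rightarrow> 'a \<times> 'a \<Rightarrow> 'a \<times> 'a" and f2 g2 :: "'v \<Rightarrow> 'a \<Rightarrow> 'a"
    and E1 :: "'u set" and E2 :: "'v set"
  defines "S \<equiv> carrier (G \<times>\<times> G)"
  defines "T1 \<equiv> \<lambda>M F H. {w \<in> E1. agrees (P1 w) M \<and> agrees (f1 w) F \<and> agrees (g1 w) H}"
    and "T2 \<equiv> \<lambda>M F H. {w \<in> E2. agrees (P2 w) M \<and> agrees (f2 w) F \<and> agrees (g2 w) H}"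
  assumes C: "finite (carrier G)" and E: "finite E1" "finite E2" and c1: "c1 \<ge> 0"
    and w1: "\<And>w. w \<in> E1 \<Longrightarrow> bij_betw (P1 w) S S \<and> f1 w \<in> carrier G \<rightarrow> carrier G \<and> g1 w \<in> carrier G \<rightarrow> carrier G"
    and w2: "\<And>w. w \<in> E2 \<Longrightarrow> bij_betw (P2 w) S S \<and> f2 w \<in> carrier G \<rightarrow> carrier G \<and> g2 w \<in> carrier G \<rightarrow> carrier G"
    and ratio: "\<And>M F H. \<lbrakk>M \<subseteq> S \<times> S; F \<subseteq> carrier G \<times> carrier G; H \<subseteq> carrier G \<times> carrier G;
        card M \<le> qc; card F \<le> qf; card H \<le> qg\<rbrakk> \<Longrightarrow> c2 * card (T2 M F H) \<le> c1 * card (T1 M F H)"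
  assumes "M \<subseteq> S \<times> S" "F \<subseteq> carrier G \<times> carrier G" "H \<subseteq> carrier G \<times> carrier G"
    and "card M + nc \<le> qc" "card F + nf \<le> qf" "card H + ng \<le> qg"
    and "\<And>w. w \<in> T2 M F H \<Longrightarrow>
      run_bounded G (P2 w) (inv_into S (P2 w)) (f2 w) (g2 w) A nc nf ng"
  shows "c2 * (\<Sum>w\<in>T2 M F H. pmf (run (P2 w) (inv_into S (P2 w)) (f2 w) (g2 w) A) b)
    \<le> c1 * (\<Sum>w\<in>T1 M F H. pmf (run (P1 w) (inv_into S (P1 w)) (f1 w) (g1 w) A) b)"
  (is "c2 * (\<Sum>w\<in>_. ?r2 w A) \<le> c1 * (\<Sum>w\<in>_. ?r1 w A)")
  using assms(11-17)
proof (induction A arbitrary: M F H nc nf ng)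
  case (Output b')
  have "c2 * card (T2 M F H) \<le> c1 * card (T1 M F H)"
    using Output by (intro ratio) auto
  then show ?case by (auto simp: indicator_def)
next
  case (Toss p K)
  \<comment> \<open>Integrability lets the expectation over the coins commute with the finite sums
    over worlds and preserve the inequality.\<close>
  have int: "integrable (measure_pmf p) (\<lambda>n. pmf (q n) b)" for q
    by (rule measure_pmf.integrable_const_bound[where B = 1]) (auto simp: pmf_le_1)
  have "c2 * (\<Sum>w\<in>T2 M F H. ?r2 w (K n))
    \<le> c1 * (\<Sum>w\<in>T1 M F H. ?r1 w (K n))"
    if "n \<in> set_pmf p" for n
    using Toss.prems that by (intro Toss.IH[of "K n" M F H nc nf ng]) auto
  then have "measure_pmf.expectation p (\<lambda>n. c2 * (\<Sum>w\<in>T2 M F H. ?r2 w (K n)))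
    \<le> measure_pmf.expectation p (\<lambda>n. c1 * (\<Sum>w\<in>T1 M F H. ?r1 w (K n)))"
    by (intro integral_mono_AE) (auto simp: AE_measure_pmf_iff int)
  then show ?case
    by (simp add: pmf_bind int)
next
  case (Query_fwd x K)
  show ?case
  \<comment> \<open>A remaining world of the second family certifies, through
    \<open>run_bounded\<close>, that the query is legal and the budget positive. Without such a
    world the left sum is empty.\<close>
  proof (cases "T2 M F H = {}")
    case True
    then show ?thesis using c1 by (simp add: sum_nonneg)
  next
    case False
    then have x: "x \<in> S" "nc > 0" using Query_fwd.prems(7) by (auto simp: S_def)
    have S: "finite S" using C by (simp add: S_def)
    have fin: "finite M" "finite (T1 M F H)" "finite (T2 M F H)"
      using Query_fwd.prems(1) S E finite_subset by (blast, auto simp: T1_def T2_def)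
    have bij1: "bij_betw (P1 w) S S" if "w \<in> T1 M F H" for w
      using that w1 by (auto simp: T1_def)
    have bij2: "bij_betw (P2 w) S S" if "w \<in> T2 M F H" for w
      using that w2 by (auto simp: T2_def)
    have mem: "P1 w x \<in> S" if "w \<in> T1 M F H" for w
      using bij1[OF that] x by (auto intro: bij_betw_apply bij_betw_apply[OF bij_betw_inv_into])
    have mem': "P2 w x \<in> S" if "w \<in> T2 M F H" for w
      using bij2[OF that] x by (auto intro: bij_betw_apply bij_betw_apply[OF bij_betw_inv_into])
    have e1: "T1 (insert (x, y) M) F H = {w \<in> T1 M F H. P1 w x = y}" if "y \<in> S" for y
      using bij1 that x by (auto simp: T1_def)
    have e2: "T2 (insert (x, y) M) F H = {w \<in> T2 M F H. P2 w x = y}" if "y \<in> S" for y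
      using bij2 that x by (auto simp: T2_def)
    \<comment> \<open>The pair enlarges \<open>M\<close> by at most one while \<open>nc\<close>
      drops by one, so \<open>card M + nc\<close> stays within \<open>qc\<close>; if
      \<open>x\<close> was asked before, \<open>M\<close> does not grow at all.\<close>
    have "c2 * (\<Sum>w\<in>T2 (insert (x, y) M) F H. ?r2 w (K y)) \<le> c1 * (\<Sum>w\<in>T1 (insert (x, y) M) F H. ?r1 w (K y))"
      if "y \<in> S" for y
      using Query_fwd.prems that x fin
      by (intro Query_fwd.IH[of "K y" _ F H "nc - 1" nf ng]) (auto simp: card_insert_if e2)
    then show ?thesis
      using sum_fibres_le[OF fin(2,3) S mem mem', where hu = "\<lambda>y w. ?r1 w (K y)" and hv = "\<lambda>y w. ?r2 w (K y)"]
      by (simp add: e1 e2)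
  qed
next
  case (Query_bwd x K)
  show ?case
  proof (cases "T2 M F H = {}")
    case True
    then show ?thesis using c1 by (simp add: sum_nonneg)
  next
    case False
    then have x: "x \<in> S" "nc > 0" using Query_bwd.prems(7) by (auto simp: S_def)
    have S: "finite S" using C by (simp add: S_def)
    have fin: "finite M" "finite (T1 M F H)" "finite (T2 M F H)"
      using Query_bwd.prems(1) S E finite_subset by (blast, auto simp: T1_def T2_def)
    have bij1: "bij_betw (P1 w) S S" if "w \<in> T1 M F H" for w
      using that w1 by (auto simp: T1_def)
    have bij2: "bij_betw (P2 w) S S" if "w \<in> T2 M F H" for w
      using that w2 by (auto simp: T2_def)
    have mem: "inv_into S (P1 w) x \<in> S" if "w \<in> T1 M F H" for w
      using bij1[OF that] x by (auto intro: bij_betw_apply bij_betw_apply[OF bij_betw_inv_into])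
    have mem': "inv_into S (P2 w) x \<in> S" if "w \<in> T2 M F H" for w
      using bij2[OF that] x by (auto intro: bij_betw_apply bij_betw_apply[OF bij_betw_inv_into])
    \<comment> \<open>The answer \<open>y\<close> of an inverse query is recorded as the plaintext;
      bijectivity turns the condition on the inverse into one on \<open>P1 w\<close>.\<close>
    have e1: "T1 (insert (y, x) M) F H = {w \<in> T1 M F H. inv_into S (P1 w) x = y}" if "y \<in> S" for y
    proof -
      have "P1 w y = x \<longleftrightarrow> inv_into S (P1 w) x = y" if "w \<in> T1 M F H" for w
        using bij_betw_inv_into_left[OF bij1[OF that]] bij_betw_inv_into_right[OF bij1[OF that]] \<open>y \<in> S\<close> x
        by blast
      then show ?thesis by (auto simp: T1_def)
    qed
    have e2: "T2 (insert (y, x) M) F H = {w \<in> T2 M F H. inv_into S (P2 w) x = y}" if "y \<in> S" for y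
    proof -
      have "P2 w y = x \<longleftrightarrow> inv_into S (P2 w) x = y" if "w \<in> T2 M F H" for w
        using bij_betw_inv_into_left[OF bij2[OF that]] bij_betw_inv_into_right[OF bij2[OF that]] \<open>y \<in> S\<close> x
        by blast
      then show ?thesis by (auto simp: T2_def)
    qed
    have "c2 * (\<Sum>w\<in>T2 (insert (y, x) M) F H. ?r2 w (K y)) \<le> c1 * (\<Sum>w\<in>T1 (insert (y, x) M) F H. ?r1 w (K y))"
      if "y \<in> S" for y
      using Query_bwd.prems that x fin
      by (intro Query_bwd.IH[of "K y" _ F H "nc - 1" nf ng]) (auto simp: card_insert_if e2)
    then show ?thesis
      using sum_fibres_le[OF fin(2,3) S mem mem', where hu = "\<lambda>y w. ?r1 w (K y)" and hv = "\<lambda>y w. ?r2 w (K y)"]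
      by (simp add: e1 e2)
  qed
next
  case (Query_f x K)
  show ?case
  proof (cases "T2 M F H = {}")
    case True
    then show ?thesis using c1 by (simp add: sum_nonneg)
  next
    case False
    then have x: "x \<in> carrier G" "nf > 0" using Query_f.prems(7) by auto
    have fin: "finite F" "finite (T1 M F H)" "finite (T2 M F H)"
      using Query_f.prems(2) C E finite_subset by (blast, auto simp: T1_def T2_def)
    have mem: "f1 w x \<in> carrier G" if "w \<in> T1 M F H" for w
      using that w1[of w] x by (auto simp: T1_def)
    have mem': "f2 w x \<in> carrier G" if "w \<in> T2 M F H" for w
      using that w2[of w] x by (auto simp: T2_def)
    have e1: "T1 M (insert (x, y) F) H = {w \<in> T1 M F H. f1 w x = y}"
      and e2: "T2 M (insert (x, y) F) H = {w \<in> T2 M F H. f2 w x = y}" for y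
      by (auto simp: T1_def T2_def)
    have "c2 * (\<Sum>w\<in>T2 M (insert (x, y) F) H. ?r2 w (K y)) \<le> c1 * (\<Sum>w\<in>T1 M (insert (x, y) F) H. ?r1 w (K y))"
      if "y \<in> carrier G" for y
      using Query_f.prems that x fin
      by (intro Query_f.IH[of "K y" M _ H nc "nf - 1" ng]) (auto simp: card_insert_if e2)
    then show ?thesis
      using sum_fibres_le[OF fin(2,3) C mem mem', where hu = "\<lambda>y w. ?r1 w (K y)" and hv = "\<lambda>y w. ?r2 w (K y)"]
      by (simp add: e1 e2)
  qed
next
  case (Query_g x K)
  show ?case
  proof (cases "T2 M F H = {}")
    case True
    then show ?thesis using c1 by (simp add: sum_nonneg)
  next
    case False
    then have x: "x \<in> carrier G" "ng > 0" using Query_g.prems(7) by auto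
    have fin: "finite H" "finite (T1 M F H)" "finite (T2 M F H)"
      using Query_g.prems(3) C E finite_subset by (blast, auto simp: T1_def T2_def)
    have mem: "g1 w x \<in> carrier G" if "w \<in> T1 M F H" for w
      using that w1[of w] x by (auto simp: T1_def)
    have mem': "g2 w x \<in> carrier G" if "w \<in> T2 M F H" for w
      using that w2[of w] x by (auto simp: T2_def)
    have e1: "T1 M F (insert (x, y) H) = {w \<in> T1 M F H. g1 w x = y}"
      and e2: "T2 M F (insert (x, y) H) = {w \<in> T2 M F H. g2 w x = y}" for y
      by (auto simp: T1_def T2_def)
    have "c2 * (\<Sum>w\<in>T2 M F (insert (x, y) H). ?r2 w (K y)) \<le> c1 * (\<Sum>w\<in>T1 M F (insert (x, y) H). ?r1 w (K y))"
      if "y \<in> carrier G" for y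
      using Query_g.prems that x fin
      by (intro Query_g.IH[of "K y" M F _ nc nf "ng - 1"]) (auto simp: card_insert_if e2)
    then show ?thesis
      using sum_fibres_le[OF fin(2,3) C mem mem', where hu = "\<lambda>y w. ?r1 w (K y)" and hv = "\<lambda>y w. ?r2 w (K y)"]
      by (simp add: e1 e2)
  qed
qed

section \<open>The cipher evaluated from both ends\<close>

context group
begin

text \<open>
  In the following, \<open>w = (kl, kr, g)\<close> collects the key and the outer round function, and
  \<open>p = ((L, R), (S, T))\<close> is a plaintext-ciphertext pair. Computing from both ends, \<open>p\<close> determines
  the two inputs \<open>g_in\<close>, \<open>g_in'\<close> of \<open>g\<close>, hence the two inputs \<open>f_in\<close>, \<open>f_in'\<close> of \<open>f\<close>, and
  the values that \<open>f\<close> has to take there.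
\<close>

definition g_in :: "'a \<times> 'a \<times> ('a \<Rightarrow> 'a) \<Rightarrow> ('a \<times> 'a) \<times> ('a \<times> 'a) \<Rightarrow> 'a" where
  "g_in = (\<lambda>(kl, kr, g) ((L, R), (S, T)). R \<otimes> kr)"

definition g_in' :: "'a \<times> 'a \<times> ('a \<Rightarrow> 'a) \<Rightarrow> ('a \<times> 'a) \<times> ('a \<times> 'a) \<Rightarrow> 'a" where
  "g_in' = (\<lambda>(kl, kr, g) ((L, R), (S, T)). S \<otimes> inv kl)"

definition f_in :: "'a \<times> 'a \<times> ('a \<Rightarrow> 'a) \<Rightarrow> ('a \<times> 'a) \<times> ('a \<times> 'a) \<Rightarrow> 'a" where
  "f_in = (\<lambda>(kl, kr, g) ((L, R), (S, T)). L \<otimes> kl \<otimes> g (R \<otimes> kr))"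

definition f_in' :: "'a \<times> 'a \<times> ('a \<Rightarrow> 'a) \<Rightarrow> ('a \<times> 'a) \<times> ('a \<times> 'a) \<Rightarrow> 'a" where
  "f_in' = (\<lambda>(kl, kr, g) ((L, R), (S, T)). T \<otimes> inv kr \<otimes> inv (g (S \<otimes> inv kl)))"

definition f_constraints ::
  "'a \<times> 'a \<times> ('a \<Rightarrow> 'a) \<Rightarrow> (('a \<times> 'a) \<times> ('a \<times> 'a)) set \<Rightarrow> ('a \<times> 'a) set" where
  "f_constraints w M = (\<lambda>p. (f_in w p, inv (g_in w p) \<otimes> f_in' w p)) ` M
     \<union> (\<lambda>p. (f_in' w p, inv (f_in w p) \<otimes> g_in' w p)) ` M"

text \<open>Sufficient for the constraints on \<open>f\<close> to be compatible with each other and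
  with \<open>F\<close>. The case \<open>p' = p\<close> is included in the first inequality: the two
  inputs coming from a single pair must differ too.\<close>

definition good :: "(('a \<times> 'a) \<times> ('a \<times> 'a)) set \<Rightarrow> ('a \<times> 'a) set \<Rightarrow> ('a \<times> 'a) set \<Rightarrow>
    'a \<times> 'a \<times> ('a \<Rightarrow> 'a) \<Rightarrow> bool" where
  "good M F H w \<longleftrightarrow>
     (\<forall>p\<in>M. f_in w p \<notin> Domain F \<and> f_in' w p \<notin> Domain F \<and>
        (\<forall>p'\<in>M. f_in w p \<noteq> f_in' w p' \<and>
           (p \<noteq> p' \<longrightarrow> f_in w p \<noteq> f_in w p' \<and> f_in' w p \<noteq> f_in' w p')))"

text \<open>Conditioned on the queries to \<open>g\<close> but free of \<open>f\<close>, which is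
  chosen last, once the key and \<open>g\<close> have fixed the constraints on it.\<close>

definition key_worlds :: "('a \<times> 'a) set \<Rightarrow> ('a \<times> 'a \<times> ('a \<Rightarrow> 'a)) set" where
  "key_worlds H = carrier G \<times> carrier G \<times> {g \<in> carrier G \<rightarrow>\<^sub>E carrier G. agrees g H}"

lemma finite_key_worlds [intro]: "finite (carrier G) \<Longrightarrow> finite (key_worlds H)"
  unfolding key_worlds_def
  by (rule finite_subset[of _ "carrier G \<times> carrier G \<times> (carrier G \<rightarrow>\<^sub>E carrier G)"])
    (auto intro!: finite_PiE)

text \<open>The plaintext determines the state after the first round and the ciphertext the state
  before the last one; the two constraints on \<open>f\<close> make the middle rounds lead from one
  to the other.\<close>

lemma cipher_eq:
  assumes "f \<in> carrier G \<rightarrow> carrier G" "(kl, kr, g) \<in> key_worlds H"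
    and p: "(x, y) \<in> M" and M: "M \<subseteq> carrier (G \<times>\<times> G) \<times> carrier (G \<times>\<times> G)"
    and agrees: "agrees f (f_constraints (kl, kr, g) M)"
  shows "cipher G f g (kl, kr) x = y"
proof -
  obtain L R S T where xy: "x = (L, R)" "y = (S, T)" by (cases x, cases y)
  have in_carrier: "L \<in> carrier G" "R \<in> carrier G" "S \<in> carrier G" "T \<in> carrier G"
      "kl \<in> carrier G" "kr \<in> carrier G" "g \<in> carrier G \<rightarrow> carrier G"
    using assms(2) p M by (auto simp: xy key_worlds_def)
  define b c where "b = R \<otimes> kr" and "c = S \<otimes> inv kl"
  have bc: "b \<in> carrier G" "c \<in> carrier G"
    using in_carrier by (auto simp: b_def c_def)
  then have gbc: "g b \<in> carrier G" "g c \<in> carrier G"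
    using in_carrier(7) by auto
  define u v where "u = L \<otimes> kl \<otimes> g b" and "v = T \<otimes> inv kr \<otimes> inv (g c)"
  have uv: "u \<in> carrier G" "v \<in> carrier G"
    using in_carrier gbc by (auto simp: u_def v_def)
  have "(u, inv b \<otimes> v) \<in> f_constraints (kl, kr, g) M"
    unfolding f_constraints_def
    by (rule UnI1, rule image_eqI[OF _ p])
      (simp add: xy f_in_def f_in'_def g_in_def b_def c_def u_def v_def)
  moreover have "(v, inv u \<otimes> c) \<in> f_constraints (kl, kr, g) M"
    unfolding f_constraints_def
    by (rule UnI2, rule image_eqI[OF _ p])
      (simp add: xy f_in_def f_in'_def g_in'_def b_def c_def u_def v_def)
  ultimately have f: "f u = inv b \<otimes> v" "f v = inv u \<otimes> c"
    using agreesD[OF agrees] by auto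
  \<comment> \<open>The successive states are \<open>(b, u)\<close>, \<open>(u, v)\<close>,
    \<open>(v, c)\<close> and \<open>(c, T \<otimes> inv kr)\<close>.\<close>
  have "b \<otimes> f u = v" "u \<otimes> f v = c"
    unfolding f by (simp_all add: m_assoc[symmetric] bc uv)
  moreover have "v \<otimes> g c = T \<otimes> inv kr"
    by (simp add: v_def m_assoc gbc in_carrier)
  then have "v \<otimes> g c \<otimes> kr = T"
    by (simp add: m_assoc in_carrier)
  moreover have "c \<otimes> kl = S"
    by (simp add: c_def m_assoc in_carrier)
  ultimately show ?thesis
    by (simp add: xy cipher_def feistel4_def feistel_def
        b_def[symmetric] u_def[symmetric])
qed

section \<open>Bad coincidences and their proportion among keys and outer round functions\<close>

text \<open>The value of \<open>g\<close> at \<open>u kl kr\<close> is overwritten. The point avoids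
  \<open>Domain H\<close>, so the new function still agrees with \<open>H\<close>; it depends on the
  key alone, so it can be read off from the updated world; and by \<open>det\<close> the lost value
  is recoverable from the rest, which gives injectivity.\<close>

lemma resample_value:
  assumes fin: "finite (carrier G)" and D: "D \<subseteq> key_worlds H"
    and u: "\<And>kl kr g. (kl, kr, g) \<in> D \<Longrightarrow> u kl kr \<in> carrier G - Domain H"
    and det: "\<And>kl kr g g'. \<lbrakk>(kl, kr, g) \<in> D; (kl, kr, g') \<in> D; \<And>z. z \<noteq> u kl kr \<Longrightarrow> g z = g' z\<rbrakk>
      \<Longrightarrow> g (u kl kr) = g' (u kl kr)"
  shows "card (carrier G) * card D \<le> card (key_worlds H)"
proof (rule card_mult_le_via_inj[where upd = "\<lambda>v (kl, kr, g). (kl, kr, g(u kl kr := v))"])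
  show "finite (key_worlds H)" by (rule finite_key_worlds[OF fin])
  show "D \<subseteq> key_worlds H" by fact
  show "(case w of (kl, kr, g) \<Rightarrow> (kl, kr, g(u kl kr := v))) \<in> key_worlds H"
    if "v \<in> carrier G" "w \<in> D" for v w
  proof -
    obtain kl kr g where w: "w = (kl, kr, g)" by (cases w)
    have u: "u kl kr \<in> carrier G" "u kl kr \<notin> Domain H" and "w \<in> key_worlds H"
      using assms(3)[of kl kr g] D that(2) by (auto simp: w)
    then have g: "kl \<in> carrier G" "kr \<in> carrier G" "g \<in> carrier G \<rightarrow>\<^sub>E carrier G" "agrees g H"
      by (auto simp: w key_worlds_def)
    have "g(u kl kr := v) \<in> carrier G \<rightarrow>\<^sub>E carrier G"
      using PiE_fun_upd[OF that(1) g(3), of "u kl kr"] u(1) by (simp add: insert_absorb)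
    moreover have "agrees (g(u kl kr := v)) H"
      using g(4) u(2) by (auto simp: agrees_def)
    ultimately show ?thesis
      using g by (simp add: w key_worlds_def)
  qed
  show "v = v' \<and> w = w'"
    if "w \<in> D" "w' \<in> D"
      and eq: "(case w of (kl, kr, g) \<Rightarrow> (kl, kr, g(u kl kr := v)))
        = (case w' of (kl, kr, g) \<Rightarrow> (kl, kr, g(u kl kr := v')))" for v w v' w'
  proof -
    obtain kl kr g where w: "w = (kl, kr, g)" by (cases w)
    obtain g' where w': "w' = (kl, kr, g')" using eq by (cases w') (auto simp: w)
    have upd: "g(u kl kr := v) = g'(u kl kr := v')" using eq by (simp add: w w')
    then have "v = v'" by (auto dest: fun_cong[where x = "u kl kr"])
    have off: "g z = g' z" if "z \<noteq> u kl kr" for z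
      using fun_cong[OF upd, of z] that by simp
    have "g (u kl kr) = g' (u kl kr)"
      by (rule det[of kl kr g g', OF _ _ off]) (use that(1,2) in \<open>simp_all add: w w'\<close>)
    then have "g z = g' z" for z using off by (cases "z = u kl kr") simp_all
    then have "g = g'" by (rule ext)
    then show ?thesis using \<open>v = v'\<close> by (simp add: w w')
  qed
qed

context
  fixes H :: "('a \<times> 'a) set"
  assumes fin: "finite (carrier G)"
begin

text \<open>Overwriting \<open>kr\<close> is injective, since \<open>R \<otimes> kr = h\<close>
  recovers it by left cancellation.\<close>

lemma card_g_in_eq:
  assumes "p \<in> carrier (G \<times>\<times> G) \<times> carrier (G \<times>\<times> G)"
  shows "card (carrier G) * card {w \<in> key_worlds H. g_in w p = h} \<le> card (key_worlds H)"
  by (rule card_mult_le_via_inj[where upd = "\<lambda>v (kl, kr, g). (kl, v, g)"])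
    (use fin assms in \<open>auto simp: key_worlds_def g_in_def intro!: finite_key_worlds[unfolded key_worlds_def]\<close>)

text \<open>Here \<open>kl\<close> is overwritten; \<open>S \<otimes> inv kl = h\<close> recovers it
  by cancellation followed by inversion.\<close>

lemma card_g_in'_eq:
  assumes "p \<in> carrier (G \<times>\<times> G) \<times> carrier (G \<times>\<times> G)"
  shows "card (carrier G) * card {w \<in> key_worlds H. g_in' w p = h} \<le> card (key_worlds H)"
proof (rule card_mult_le_via_inj[where upd = "\<lambda>v (kl, kr, g). (v, kr, g)"])
  fix v w v' w'
  assume "w \<in> {w \<in> key_worlds H. g_in' w p = h}" "w' \<in> {w \<in> key_worlds H. g_in' w p = h}"
    "(case w of (kl, kr, g) \<Rightarrow> (v, kr, g)) = (case w' of (kl, kr, g) \<Rightarrow> (v', kr, g))"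
  then obtain kl kl' kr g L R S T where w: "w = (kl, kr, g)" "w' = (kl', kr, g)" "v = v'"
      "S \<in> carrier G" "kl \<in> carrier G" "kl' \<in> carrier G"
      "S \<otimes> inv kl = h" "S \<otimes> inv kl' = h"
    using assms(1) by (auto simp: key_worlds_def g_in'_def)
  then have "inv kl = inv kl'"
    by (metis l_cancel inv_closed)
  then show "v = v' \<and> w = w'"
    using w by (metis inv_inv)
qed (use fin in \<open>auto simp: key_worlds_def intro!: finite_key_worlds[unfolded key_worlds_def]\<close>)

text \<open>As \<open>g_in'\<close> depends on \<open>kl\<close> but not on \<open>kr\<close>, the
  coincidence recovers an overwritten \<open>kr\<close>. This covers \<open>p = p'\<close> as
  well.\<close>

lemma card_g_in_eq_g_in':
  assumes "p \<in> carrier (G \<times>\<times> G) \<times> carrier (G \<times>\<times> G)" "p' \<in> carrier (G \<times>\<times> G) \<times> carrier (G \<times>\<times> G)"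
  shows "card (carrier G) * card {w \<in> key_worlds H. g_in w p = g_in' w p'} \<le> card (key_worlds H)"
proof (rule card_mult_le_via_inj[where upd = "\<lambda>v (kl, kr, g). (kl, v, g)"])
  fix v w v' w'
  assume "w \<in> {w \<in> key_worlds H. g_in w p = g_in' w p'}" "w' \<in> {w \<in> key_worlds H. g_in w p = g_in' w p'}"
    "(case w of (kl, kr, g) \<Rightarrow> (kl, v, g)) = (case w' of (kl, kr, g) \<Rightarrow> (kl, v', g))"
  then obtain kl kr kr' g L R S T where w: "w = (kl, kr, g)" "w' = (kl, kr', g)" "v = v'"
      "p = ((L, R), (S, T))" "R \<in> carrier G" "kr \<in> carrier G" "kr' \<in> carrier G"
      "R \<otimes> kr = g_in' w p'" "R \<otimes> kr' = g_in' w' p'"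
    using assms(1) by (auto simp: key_worlds_def g_in_def)
  moreover have "g_in' w p' = g_in' w' p'"
    by (cases p') (simp add: w(1,2) g_in'_def)
  ultimately show "v = v' \<and> w = w'"
    by (metis l_cancel)
qed (use fin in \<open>auto simp: key_worlds_def intro!: finite_key_worlds[unfolded key_worlds_def]\<close>)

text \<open>
  Once \<open>f_in w p = \<psi> w\<close> is required, where \<open>\<psi> w\<close> does not depend on the value of \<open>g\<close> at
  \<open>g_in w p\<close>, that value is determined by the rest of \<open>w\<close>.
\<close>

lemma card_f_in_eq:
  assumes p: "p \<in> carrier (G \<times>\<times> G) \<times> carrier (G \<times>\<times> G)"
    and D: "D \<subseteq> {w \<in> key_worlds H. g_in w p \<notin> Domain H \<and> f_in w p = \<psi> w}"
    and \<psi>: "\<And>kl kr g g'. \<lbrakk>(kl, kr, g) \<in> D; (kl, kr, g') \<in> D; \<And>z. z \<noteq> g_in (kl, kr, g) p \<Longrightarrow> g z = g' z\<rbrakk>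
      \<Longrightarrow> \<psi> (kl, kr, g) = \<psi> (kl, kr, g')"
  shows "card (carrier G) * card D \<le> card (key_worlds H)"
proof (rule resample_value[OF fin, where u = "\<lambda>kl kr. g_in (kl, kr, undefined) p"])
  show "D \<subseteq> key_worlds H" using D by auto
  \<comment> \<open>\<open>undefined\<close> is a mere placeholder: \<open>g_in\<close> ignores the
    round function, so the resampled point is a function of the key.\<close>
  have g_in: "g_in (kl, kr, undefined) p = g_in (kl, kr, g) p" for kl kr g
    by (cases p) (auto simp: g_in_def)
  show "g_in (kl, kr, undefined) p \<in> carrier G - Domain H" if "(kl, kr, g) \<in> D" for kl kr g
  proof -
    have w: "(kl, kr, g) \<in> key_worlds H" "g_in (kl, kr, g) p \<notin> Domain H" using that D by auto
    then have "g_in (kl, kr, g) p \<in> carrier G"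
      using p by (auto simp: key_worlds_def g_in_def)
    then show ?thesis using w(2) by (simp add: g_in[of _ _ g])
  qed
  show "g (g_in (kl, kr, undefined) p) = g' (g_in (kl, kr, undefined) p)"
    if w: "(kl, kr, g) \<in> D" "(kl, kr, g') \<in> D"
      and off: "\<And>z. z \<noteq> g_in (kl, kr, undefined) p \<Longrightarrow> g z = g' z" for kl kr g g'
  proof -
    have "\<psi> (kl, kr, g) = \<psi> (kl, kr, g')"
      using w off by (intro \<psi>) (auto simp: g_in[of _ _ g])
    moreover have "f_in (kl, kr, g) p = \<psi> (kl, kr, g)" "f_in (kl, kr, g') p = \<psi> (kl, kr, g')"
      using w D by blast+
    ultimately have eq: "f_in (kl, kr, g) p = f_in (kl, kr, g') p"
      by simp
    have "(kl, kr, g) \<in> key_worlds H" "(kl, kr, g') \<in> key_worlds H" using w D by auto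
    then have car: "kl \<in> carrier G" "kr \<in> carrier G" "\<And>z. z \<in> carrier G \<Longrightarrow> g z \<in> carrier G"
        "\<And>z. z \<in> carrier G \<Longrightarrow> g' z \<in> carrier G"
      by (auto simp: key_worlds_def)
    obtain L R S T where ps: "p = ((L, R), (S, T))" by (metis surj_pair)
    then have "L \<in> carrier G" "R \<in> carrier G" "S \<in> carrier G" "T \<in> carrier G"
      using p by auto
    then show ?thesis using eq car
      by (simp add: ps g_in_def f_in_def)
  qed
qed

text \<open>Counterpart from the ciphertext side. The value of \<open>g\<close> enters through its
  inverse, so recovering it takes injectivity of inversion besides cancellation.\<close>

lemma card_f_in'_eq:
  assumes p: "p \<in> carrier (G \<times>\<times> G) \<times> carrier (G \<times>\<times> G)"
    and D: "D \<subseteq> {w \<in> key_worlds H. g_in' w p \<notin> Domain H \<and> f_in' w p = \<psi> w}"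
    and \<psi>: "\<And>kl kr g g'. \<lbrakk>(kl, kr, g) \<in> D; (kl, kr, g') \<in> D; \<And>z. z \<noteq> g_in' (kl, kr, g) p \<Longrightarrow> g z = g' z\<rbrakk>
      \<Longrightarrow> \<psi> (kl, kr, g) = \<psi> (kl, kr, g')"
  shows "card (carrier G) * card D \<le> card (key_worlds H)"
proof (rule resample_value[OF fin, where u = "\<lambda>kl kr. g_in' (kl, kr, undefined) p"])
  show "D \<subseteq> key_worlds H" using D by auto
  have g_in': "g_in' (kl, kr, undefined) p = g_in' (kl, kr, g) p" for kl kr g
    by (cases p) (auto simp: g_in'_def)
  show "g_in' (kl, kr, undefined) p \<in> carrier G - Domain H" if "(kl, kr, g) \<in> D" for kl kr g
  proof -
    have w: "(kl, kr, g) \<in> key_worlds H" "g_in' (kl, kr, g) p \<notin> Domain H" using that D by auto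
    then have "g_in' (kl, kr, g) p \<in> carrier G"
      using p by (auto simp: key_worlds_def g_in'_def)
    then show ?thesis using w(2) by (simp add: g_in'[of _ _ g])
  qed
  show "g (g_in' (kl, kr, undefined) p) = g' (g_in' (kl, kr, undefined) p)"
    if w: "(kl, kr, g) \<in> D" "(kl, kr, g') \<in> D"
      and off: "\<And>z. z \<noteq> g_in' (kl, kr, undefined) p \<Longrightarrow> g z = g' z" for kl kr g g'
  proof -
    have "\<psi> (kl, kr, g) = \<psi> (kl, kr, g')"
      using w off by (intro \<psi>) (auto simp: g_in'[of _ _ g])
    moreover have "f_in' (kl, kr, g) p = \<psi> (kl, kr, g)" "f_in' (kl, kr, g') p = \<psi> (kl, kr, g')"
      using w D by blast+
    ultimately have eq: "f_in' (kl, kr, g) p = f_in' (kl, kr, g') p"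
      by simp
    have "(kl, kr, g) \<in> key_worlds H" "(kl, kr, g') \<in> key_worlds H" using w D by auto
    then have car: "kl \<in> carrier G" "kr \<in> carrier G" "\<And>z. z \<in> carrier G \<Longrightarrow> g z \<in> carrier G"
        "\<And>z. z \<in> carrier G \<Longrightarrow> g' z \<in> carrier G"
      by (auto simp: key_worlds_def)
    obtain L R S T where ps: "p = ((L, R), (S, T))" by (metis surj_pair)
    then have "L \<in> carrier G" "R \<in> carrier G" "S \<in> carrier G" "T \<in> carrier G"
      using p by auto
    then show ?thesis using eq car
      by (simp add: ps g_in'_def f_in'_def inj_on_eq_iff[OF inv_inj])
  qed
qed

lemma card_union_le:
  assumes "finite I" "\<And>i. i \<in> I \<Longrightarrow> card (carrier G) * card (B i) \<le> t"
  shows "card (carrier G) * card (\<Union>i\<in>I. B i) \<le> card I * t"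
proof -
  have "card (carrier G) * card (\<Union>i\<in>I. B i) \<le> (\<Sum>i\<in>I. card (carrier G) * card (B i))"
    using card_UN_le[OF assms(1), of B] by (simp add: sum_distrib_left[symmetric])
  also have "\<dots> \<le> card I * t"
    using sum_mono[OF assms(2)] by simp
  finally show ?thesis .
qed

text \<open>Union bound over eight families of coincidences, each single coincidence having
  proportion at most \<open>1 / N\<close>. The products count the coincidences: with points of
  \<open>H\<close>, with points of \<open>F\<close>, between the two ends (once for \<open>g\<close>
  and once for \<open>f\<close>), and between distinct pairs at the same end.\<close>

lemma card_bad_le:
  assumes M: "M \<subseteq> carrier (G \<times>\<times> G) \<times> carrier (G \<times>\<times> G)" and sv: "single_valued M" "single_valued (M\<inverse>)"
    and F: "F \<subseteq> carrier G \<times> carrier G" and H: "H \<subseteq> carrier G \<times> carrier G"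
  shows "card (carrier G) * card {w \<in> key_worlds H. \<not> good M F H w}
    \<le> (2 * card M * card H + 2 * card M * card F + 2 * (card M * card M)
        + 2 * (card M * (card M - 1))) * card (key_worlds H)"
proof -
  let ?K = "key_worlds H" and ?N = "card (carrier G)"
  define MM where "MM = Sigma M (\<lambda>p. M - {p})"
  have finC: "finite (carrier (G \<times>\<times> G))" using fin by simp
  have fins: "finite M" "finite F" "finite H" "finite (Domain F)" "finite (Domain H)" "finite MM"
    using finite_subset[OF M] finite_subset[OF F] finite_subset[OF H] fin finC
    by (auto simp: MM_def finite_Domain)
  have dom: "card (Domain F) \<le> card F" "card (Domain H) \<le> card H"
    using fins by (auto simp: Domain_fst card_image_le)
  have mem: "p \<in> carrier (G \<times>\<times> G) \<times> carrier (G \<times>\<times> G)" if "p \<in> M" for p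
    using that M by auto
  \<comment> \<open>\<open>B1\<close> to \<open>B3\<close> concern inputs of \<open>g\<close>.
    \<open>B4\<close> to \<open>B8\<close> concern inputs of \<open>f\<close> and demand a fresh
    input of \<open>g\<close>, distinct from the other one where two pairs are compared, so that the
    value of \<open>g\<close> there can be overwritten.\<close>
  define B1 where "B1 = (\<lambda>(p, h). {w \<in> ?K. g_in w p = h})"
  define B2 where "B2 = (\<lambda>(p, h). {w \<in> ?K. g_in' w p = h})"
  define B3 where "B3 = (\<lambda>(p, p'). {w \<in> ?K. g_in w p = g_in' w p'})"
  define B4 where "B4 = (\<lambda>(p, u). {w \<in> ?K. g_in w p \<notin> Domain H \<and> f_in w p = u})"
  define B5 where "B5 = (\<lambda>(p, u). {w \<in> ?K. g_in' w p \<notin> Domain H \<and> f_in' w p = u})"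
  define B6 where "B6 = (\<lambda>(p, p'). {w \<in> ?K. g_in w p \<notin> Domain H \<and> g_in w p \<noteq> g_in' w p' \<and> f_in w p = f_in' w p'})"
  define B7 where "B7 = (\<lambda>(p, p'). {w \<in> ?K. g_in w p \<notin> Domain H \<and> g_in w p \<noteq> g_in w p' \<and> f_in w p = f_in w p'})"
  define B8 where "B8 = (\<lambda>(p, p'). {w \<in> ?K. g_in' w p \<notin> Domain H \<and> g_in' w p \<noteq> g_in' w p' \<and> f_in' w p = f_in' w p'})"
  have cover: "{w \<in> ?K. \<not> good M F H w} \<subseteq>
      \<Union>(B1 ` (M \<times> Domain H)) \<union> \<Union>(B2 ` (M \<times> Domain H)) \<union> \<Union>(B3 ` (M \<times> M))
      \<union> \<Union>(B4 ` (M \<times> Domain F)) \<union> \<Union>(B5 ` (M \<times> Domain F)) \<union> \<Union>(B6 ` (M \<times> M)) \<union> \<Union>(B7 ` MM) \<union> \<Union>(B8 ` MM)" (is "_ \<subseteq> ?V")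
  proof
    fix w assume "w \<in> {w \<in> ?K. \<not> good M F H w}"
    then have w: "w \<in> ?K" "\<not> good M F H w" by auto
    show "w \<in> ?V"
    proof (rule ccontr)
      assume "w \<notin> ?V"
      then have nV: "w \<notin> \<Union>(B1 ` (M \<times> Domain H))" "w \<notin> \<Union>(B2 ` (M \<times> Domain H))"
          "w \<notin> \<Union>(B3 ` (M \<times> M))" "w \<notin> \<Union>(B4 ` (M \<times> Domain F))" "w \<notin> \<Union>(B5 ` (M \<times> Domain F))"
          "w \<notin> \<Union>(B6 ` (M \<times> M))" "w \<notin> \<Union>(B7 ` MM)" "w \<notin> \<Union>(B8 ` MM)"
        by (simp_all only: Un_iff de_Morgan_disj not_False_eq_True)
      have n1: "g_in w p \<notin> Domain H" "g_in' w p \<notin> Domain H" if "p \<in> M" for p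
        using UN_I[of "(p, g_in w p)" "M \<times> Domain H" w B1] UN_I[of "(p, g_in' w p)" "M \<times> Domain H" w B2]
          nV(1,2) w(1) that unfolding B1_def B2_def by auto
      have n2: "g_in w p \<noteq> g_in' w p'" if "p \<in> M" "p' \<in> M" for p p'
        using UN_I[of "(p, p')" "M \<times> M" w B3] nV(3) w(1) that unfolding B3_def by auto
      have n3: "f_in w p \<notin> Domain F" "f_in' w p \<notin> Domain F" if "p \<in> M" for p
        using UN_I[of "(p, f_in w p)" "M \<times> Domain F" w B4] UN_I[of "(p, f_in' w p)" "M \<times> Domain F" w B5]
          nV(4,5) w(1) that n1[OF that] unfolding B4_def B5_def by auto
      have n4: "f_in w p \<noteq> f_in' w p'" if "p \<in> M" "p' \<in> M" for p p'
        using UN_I[of "(p, p')" "M \<times> M" w B6] nV(6) w(1) that n1[OF that(1)] n2[OF that] unfolding B6_def by auto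
      have "f_in w p \<noteq> f_in w p' \<and> f_in' w p \<noteq> f_in' w p'" if pp: "p \<in> M" "p' \<in> M" "p \<noteq> p'" for p p'
      proof -
        obtain kl kr g where k: "w = (kl, kr, g)" by (cases w)
        have wk: "(kl, kr, g) \<in> ?K" using w k by simp
        obtain L R S T where p: "p = ((L, R), (S, T))" by (metis surj_pair)
        obtain L' R' S' T' where p': "p' = ((L', R'), (S', T'))" by (metis surj_pair)
        have car: "L \<in> carrier G" "R \<in> carrier G" "S \<in> carrier G" "T \<in> carrier G"
          "L' \<in> carrier G" "R' \<in> carrier G" "S' \<in> carrier G" "T' \<in> carrier G"
          "kl \<in> carrier G" "kr \<in> carrier G" "\<And>z. z \<in> carrier G \<Longrightarrow> g z \<in> carrier G"
          using mem[OF pp(1)] mem[OF pp(2)] wk by (auto simp: p p' key_worlds_def)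
        have eq1: "g_in w p = g_in w p'" if "f_in w p = f_in w p'"
          using UN_I[of "(p, p')" MM w B7] nV(7) w(1) pp n1[OF pp(1)] that unfolding B7_def MM_def by auto
        have eq2: "g_in' w p = g_in' w p'" if "f_in' w p = f_in' w p'"
          using UN_I[of "(p, p')" MM w B8] nV(8) w(1) pp n1[OF pp(1)] that unfolding B8_def MM_def by auto
        \<comment> \<open>Outside \<open>B7\<close>, equal inputs of \<open>f\<close> force equal
          inputs of \<open>g\<close>. Cancellation then gives \<open>R = R'\<close> and next
          \<open>L = L'\<close>, so the plaintexts coincide and single-valuedness of
          \<open>M\<close> identifies the pairs. The ciphertext side uses \<open>M\<inverse>\<close>
          in the same way.\<close>
        have "False" if eq: "f_in w p = f_in w p'"
        proof -
          have "R = R'" using eq1[OF eq] car by (simp add: g_in_def k p p')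
          moreover from this have "L = L'" using eq car by (simp add: f_in_def k p p')
          ultimately have "p = p'" using pp sv(1) by (auto simp: p p' single_valued_def)
          then show False using pp by simp
        qed
        moreover have "False" if eq: "f_in' w p = f_in' w p'"
        proof -
          have "S = S'" using eq2[OF eq] car by (simp add: g_in'_def k p p')
          moreover from this have "T = T'" using eq car by (simp add: f_in'_def k p p')
          ultimately have "p = p'" using pp sv(2) by (auto simp: p p' single_valued_def)
          then show False using pp by simp
        qed
        ultimately show ?thesis by blast
      qed
      then have "good M F H w" using n3 n4 by (auto simp: good_def)
      then show False using w by simp
    qed
  qed
  have finV: "finite ?V"
    using finite_key_worlds[OF fin, of H] fins
    by (auto simp: B1_def B2_def B3_def B4_def B5_def B6_def B7_def B8_def)
  have c1: "?N * card (\<Union>(B1 ` (M \<times> Domain H))) \<le> card (M \<times> Domain H) * card ?K"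
    unfolding B1_def using fins mem by (intro card_union_le) (auto intro: card_g_in_eq)
  have c2: "?N * card (\<Union>(B2 ` (M \<times> Domain H))) \<le> card (M \<times> Domain H) * card ?K"
    unfolding B2_def using fins mem by (intro card_union_le) (auto intro: card_g_in'_eq)
  have c3: "?N * card (\<Union>(B3 ` (M \<times> M))) \<le> card (M \<times> M) * card ?K"
    unfolding B3_def using fins mem by (intro card_union_le) (auto intro: card_g_in_eq_g_in')
  have c4: "?N * card (\<Union>(B4 ` (M \<times> Domain F))) \<le> card (M \<times> Domain F) * card ?K"
  proof (rule card_union_le)
    fix i assume i: "i \<in> M \<times> Domain F"
    show "?N * card (B4 i) \<le> card ?K"
      by (rule card_f_in_eq[where p = "fst i" and \<psi> = "\<lambda>_. snd i"]) (use i mem in \<open>auto simp: B4_def\<close>)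
  qed (use fins in auto)
  have c5: "?N * card (\<Union>(B5 ` (M \<times> Domain F))) \<le> card (M \<times> Domain F) * card ?K"
  proof (rule card_union_le)
    fix i assume i: "i \<in> M \<times> Domain F"
    show "?N * card (B5 i) \<le> card ?K"
      by (rule card_f_in'_eq[where p = "fst i" and \<psi> = "\<lambda>_. snd i"]) (use i mem in \<open>auto simp: B5_def\<close>)
  qed (use fins in auto)
  have c6: "?N * card (\<Union>(B6 ` (M \<times> M))) \<le> card (M \<times> M) * card ?K"
  proof (rule card_union_le)
    fix i assume i: "i \<in> M \<times> M"
    \<comment> \<open>The other end evaluates \<open>g\<close> only at
      \<open>g_in' w (snd i)\<close>, which in \<open>B6\<close> differs from the resampled point,
      so \<open>f_in' w (snd i)\<close> is unaffected by the overwriting.\<close>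
    show "?N * card (B6 i) \<le> card ?K"
      by (rule card_f_in_eq[where p = "fst i" and \<psi> = "\<lambda>w. f_in' w (snd i)"])
        (use i mem in \<open>auto simp: B6_def f_in'_def g_in'_def split: prod.splits\<close>)
  qed (use fins in auto)
  have c7: "?N * card (\<Union>(B7 ` MM)) \<le> card MM * card ?K"
  proof (rule card_union_le)
    fix i assume i: "i \<in> MM"
    show "?N * card (B7 i) \<le> card ?K"
      by (rule card_f_in_eq[where p = "fst i" and \<psi> = "\<lambda>w. f_in w (snd i)"])
        (use i mem in \<open>auto simp: MM_def B7_def f_in_def g_in_def split: prod.splits\<close>)
  qed (use fins in auto)
  have c8: "?N * card (\<Union>(B8 ` MM)) \<le> card MM * card ?K"
  proof (rule card_union_le)
    fix i assume i: "i \<in> MM"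
    show "?N * card (B8 i) \<le> card ?K"
      by (rule card_f_in'_eq[where p = "fst i" and \<psi> = "\<lambda>w. f_in' w (snd i)"])
        (use i mem in \<open>auto simp: MM_def B8_def f_in'_def g_in'_def split: prod.splits\<close>)
  qed (use fins in auto)
  have cMM: "card MM = card M * (card M - 1)"
    using fins by (simp add: MM_def)
  have "?N * card {w \<in> ?K. \<not> good M F H w} \<le> ?N * card ?V"
    using card_mono[OF finV cover] by simp
  also have "\<dots> \<le> ?N * (card (\<Union>(B1 ` (M \<times> Domain H))) + card (\<Union>(B2 ` (M \<times> Domain H))) + card (\<Union>(B3 ` (M \<times> M)))
      + card (\<Union>(B4 ` (M \<times> Domain F))) + card (\<Union>(B5 ` (M \<times> Domain F))) + card (\<Union>(B6 ` (M \<times> M)))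
      + card (\<Union>(B7 ` MM)) + card (\<Union>(B8 ` MM)))"
    by (intro mult_left_mono order_trans[OF card_Un_le] add_mono order_refl) auto
  also have "\<dots> \<le> (2 * (card M * card (Domain H)) + 2 * (card M * card (Domain F)) + 2 * (card M * card M) + 2 * card MM) * card ?K"
    using c1 c2 c3 c4 c5 c6 c7 c8
    by (simp add: card_cartesian_product distrib_left distrib_right)
  also have "\<dots> \<le> (2 * card M * card H + 2 * card M * card F + 2 * (card M * card M)
        + 2 * (card M * (card M - 1))) * card ?K"
    unfolding cMM mult.assoc by (intro mult_right_mono add_mono mult_left_mono dom order_refl) auto
  finally show ?thesis .
qed

end

section \<open>Comparison of the two games for a fixed transcript\<close>

lemma f_in_closed:
  assumes "w \<in> key_worlds H" "p \<in> carrier (G \<times>\<times> G) \<times> carrier (G \<times>\<times> G)"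
  shows "f_in w p \<in> carrier G" "f_in' w p \<in> carrier G" "g_in w p \<in> carrier G" "g_in' w p \<in> carrier G"
proof -
  obtain kl kr g L R S T where w: "w = (kl, kr, g)" "p = ((L, R), (S, T))"
    by (metis surj_pair)
  then have "kl \<in> carrier G" "kr \<in> carrier G" "\<And>z. z \<in> carrier G \<Longrightarrow> g z \<in> carrier G"
    "L \<in> carrier G" "R \<in> carrier G" "S \<in> carrier G" "T \<in> carrier G"
    using assms by (auto simp: key_worlds_def)
  then show "f_in w p \<in> carrier G" "f_in' w p \<in> carrier G" "g_in w p \<in> carrier G" "g_in' w p \<in> carrier G"
    by (simp_all add: w f_in_def f_in'_def g_in_def g_in'_def)
qed

text \<open>Goodness keeps the domains of \<open>F\<close> and of the two kinds of constraints
  apart, so together they form a partial function with at most \<open>card F + 2 * card M\<close>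
  entries, each costing a factor \<open>N\<close>. The real quotient avoids truncated subtraction in
  the exponent.\<close>

lemma card_f_choices_ge:
  assumes fin: "finite (carrier G)" and M: "M \<subseteq> carrier (G \<times>\<times> G) \<times> carrier (G \<times>\<times> G)"
    and F: "F \<subseteq> carrier G \<times> carrier G" "single_valued F"
    and w: "w \<in> key_worlds H" "good M F H w"
  shows "real (card (carrier G)) ^ card (carrier G) / real (card (carrier G)) ^ (card F + 2 * card M)
    \<le> real (card {f \<in> carrier G \<rightarrow>\<^sub>E carrier G. agrees f (F \<union> f_constraints w M)})"
proof -
  let ?F = "F \<union> f_constraints w M" and ?N = "card (carrier G)"
  have finM: "finite M" "finite F"
    using finite_subset[OF M] finite_subset[OF F(1)] fin by auto
  have sub: "?F \<subseteq> carrier G \<times> carrier G"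
    using F(1) M f_in_closed[OF w(1)] unfolding f_constraints_def
    by (intro Un_least image_subsetI) auto
  have gd: "f_in w p \<notin> Domain F" "f_in' w p \<notin> Domain F" if "p \<in> M" for p
    using w(2) that by (auto simp: good_def)
  have gd2: "f_in w p \<noteq> f_in' w p'" "f_in w p = f_in w p' \<Longrightarrow> p = p'" "f_in' w p = f_in' w p' \<Longrightarrow> p = p'"
    if "p \<in> M" "p' \<in> M" for p p'
    using w(2) that unfolding good_def by blast+
  have sv: "single_valued ?F"
  proof (rule single_valuedI)
    fix x y z assume xy: "(x, y) \<in> ?F" "(x, z) \<in> ?F"
    have D: "(x, y) \<in> F \<or> (\<exists>p\<in>M. x = f_in w p \<and> y = inv (g_in w p) \<otimes> f_in' w p)
        \<or> (\<exists>p\<in>M. x = f_in' w p \<and> y = inv (f_in w p) \<otimes> g_in' w p)" if "(x, y) \<in> ?F" for y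
      using that by (auto simp: f_constraints_def)
    show "y = z"
    proof (cases "x \<in> Domain F")
      case True
      then have "(x, y) \<in> F" "(x, z) \<in> F"
        using D[OF xy(1)] D[OF xy(2)] gd by metis+
      then show ?thesis using F(2) by (auto simp: single_valued_def)
    next
      case False
      then have "(x, y) \<notin> F" "(x, z) \<notin> F" by auto
      then show ?thesis
        using D[OF xy(1)] D[OF xy(2)] gd2 by metis
    qed
  qed
  have "card ?F \<le> card F + (card M + card M)"
    unfolding f_constraints_def
    using finM by (intro order_trans[OF card_Un_le] add_mono card_image_le order_refl) auto
  then have le: "card ?F \<le> card F + 2 * card M" by simp
  have "carrier G \<noteq> {}" by auto
  then have N: "?N \<ge> 1" using fin by (simp add: Suc_leI card_gt_0_iff)
  have "card ?F = card (Domain ?F)"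
    using card_Domain_single_valued[OF sv] by simp
  also have "\<dots> \<le> ?N"
    using sub fin by (intro card_mono) auto
  finally have leN: "card ?F \<le> ?N" .
  have "real ?N ^ ?N / real ?N ^ (card F + 2 * card M) \<le> real ?N ^ ?N / real ?N ^ card ?F"
    using N le by (intro divide_left_mono power_increasing mult_pos_pos) auto
  also have "\<dots> = real ?N ^ (?N - card ?F)"
    using N leN by (simp add: power_diff)
  also have "\<dots> = real (card {f \<in> carrier G \<rightarrow>\<^sub>E carrier G. agrees f ?F})"
    using card_funcset_agrees[OF fin sub sv] by simp
  finally show ?thesis .
qed

lemma card_real_worlds_ge:
  assumes fin: "finite (carrier G)" and M: "M \<subseteq> carrier (G \<times>\<times> G) \<times> carrier (G \<times>\<times> G)"
    and F: "F \<subseteq> carrier G \<times> carrier G" "single_valued F"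
  shows "real (card {w \<in> key_worlds H. good M F H w})
      * (real (card (carrier G)) ^ card (carrier G) / real (card (carrier G)) ^ (card F + 2 * card M))
    \<le> real (card {w \<in> (carrier G \<rightarrow>\<^sub>E carrier G) \<times> (carrier G \<rightarrow>\<^sub>E carrier G) \<times> carrier (G \<times>\<times> G).
        agrees (cipher G (fst w) (fst (snd w)) (snd (snd w))) M \<and> agrees (fst w) F \<and> agrees (fst (snd w)) H})"
    (is "real (card ?good) * ?c \<le> real (card ?W)")
proof -
  define Z where "Z = Sigma ?good (\<lambda>w. {f \<in> carrier G \<rightarrow>\<^sub>E carrier G. agrees f (F \<union> f_constraints w M)})"
  have finPi: "finite (carrier G \<rightarrow>\<^sub>E carrier G)" using fin by (intro finite_PiE) auto
  have "real (card ?good) * ?c = (\<Sum>w\<in>?good. ?c)" by simp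
  also have "\<dots> \<le> (\<Sum>w\<in>?good. real (card {f \<in> carrier G \<rightarrow>\<^sub>E carrier G. agrees f (F \<union> f_constraints w M)}))"
    by (intro sum_mono card_f_choices_ge[OF fin M F]) auto
  also have "\<dots> = real (card Z)"
    unfolding Z_def using finPi finite_key_worlds[OF fin, of H] by (subst card_SigmaI) auto
  also have "card Z \<le> card ?W"
  proof (rule card_inj_on_le)
    show "inj_on (\<lambda>((kl, kr, g), f). (f, g, (kl, kr))) Z"
      by (auto simp: inj_on_def)
    have "(f, g, (kl, kr)) \<in> ?W" if "((kl, kr, g), f) \<in> Z" for kl kr g f
    proof -
      have *: "(kl, kr, g) \<in> key_worlds H" "f \<in> carrier G \<rightarrow>\<^sub>E carrier G" "agrees f F"
          "agrees f (f_constraints (kl, kr, g) M)"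
        using that by (auto simp: Z_def)
      moreover have "f \<in> carrier G \<rightarrow> carrier G" using *(2) by auto
      then have "agrees (cipher G f g (kl, kr)) M"
        using cipher_eq[OF _ *(1) _ M *(4)] unfolding agrees_def by blast
      ultimately show ?thesis by (simp add: key_worlds_def)
    qed
    then show "(\<lambda>((kl, kr, g), f). (f, g, (kl, kr))) ` Z \<subseteq> ?W"
      by (intro image_subsetI) (simp only: split_paired_all case_prod_conv)
    show "finite ?W" using finPi fin by auto
  qed
  finally show ?thesis by simp
qed

text \<open>The factors in front are the uniform weights of one world in each game, the ideal one
  scaled by \<open>1 - \<delta>\<close>. Stating \<open>\<delta>\<close> with the budgets instead of
  the actual cardinalities makes it the same for all transcripts.\<close>

lemma transcript_ratio:
  fixes q\<^sub>c q\<^sub>f q\<^sub>g :: nat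
  defines "N \<equiv> card (carrier G)"
  defines "\<delta> \<equiv> real (2 * q\<^sub>c * q\<^sub>g + 2 * q\<^sub>c * q\<^sub>f + 2 * (q\<^sub>c * q\<^sub>c) + 2 * (q\<^sub>c * (q\<^sub>c - 1))) / real N
    + real (q\<^sub>c choose 2) / real N ^ 2"
  assumes fin: "finite (carrier G)" and M: "M \<subseteq> carrier (G \<times>\<times> G) \<times> carrier (G \<times>\<times> G)"
    and F: "F \<subseteq> carrier G \<times> carrier G" and H: "H \<subseteq> carrier G \<times> carrier G"
    and q: "card M \<le> q\<^sub>c" "card F \<le> q\<^sub>f" "card H \<le> q\<^sub>g"
  shows "(1 - \<delta>) / (real N ^ N * real N ^ N * fact (N ^ 2)) *
      card {w \<in> (carrier G \<rightarrow>\<^sub>E carrier G) \<times> (carrier G \<rightarrow>\<^sub>E carrier G) \<times> {R. R permutes carrier (G \<times>\<times> G)}.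
        agrees (snd (snd w)) M \<and> agrees (fst w) F \<and> agrees (fst (snd w)) H}
    \<le> 1 / (real N ^ N * real N ^ N * real N ^ 2) *
      card {w \<in> (carrier G \<rightarrow>\<^sub>E carrier G) \<times> (carrier G \<rightarrow>\<^sub>E carrier G) \<times> carrier (G \<times>\<times> G).
        agrees (cipher G (fst w) (fst (snd w)) (snd (snd w))) M \<and> agrees (fst w) F \<and> agrees (fst (snd w)) H}"
    (is "_ * real (card ?ideal) \<le> _ * real (card ?real)")
proof (cases "?ideal = {} \<or> 1 - \<delta> \<le> 0")
  case True
  then show ?thesis
  proof
    assume "1 - \<delta> \<le> 0"
    then have "(1 - \<delta>) / (real N ^ N * real N ^ N * fact (N ^ 2)) * card ?ideal \<le> 0"
      by (intro mult_nonpos_nonneg divide_nonpos_nonneg) auto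
    also have "0 \<le> 1 / (real N ^ N * real N ^ N * real N ^ 2) * card ?real" by simp
    finally show ?thesis .
  qed (metis (no_types, lifting) card.empty mult_zero_right of_nat_0 of_nat_0_le_iff
      divide_nonneg_nonneg mult_nonneg_nonneg zero_le_one zero_le_power)
next
  case False
  \<comment> \<open>An ideal world witnesses that the transcript is consistent: its functions make
    \<open>M\<close>, \<open>F\<close> and \<open>H\<close> single-valued, and its permutation does
    the same for the converse of \<open>M\<close>.\<close>
  then obtain w where w: "w \<in> ?ideal" by blast
  have \<delta>: "\<delta> < 1" using False by simp
  let ?S = "carrier (G \<times>\<times> G)"
  have finS: "finite ?S" "card ?S = N ^ 2"
    using fin by (simp_all add: N_def card_cartesian_product power2_eq_square)
  have "carrier G \<noteq> {}" by auto
  then have N: "N \<ge> 1" using fin by (simp add: N_def Suc_leI card_gt_0_iff)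
  have agr: "agrees (snd (snd w)) M" "agrees (fst w) F" "agrees (fst (snd w)) H" "snd (snd w) permutes ?S"
    using w by auto
  have svM': "single_valued (M\<inverse>)"
  proof (rule single_valuedI)
    fix x y z assume "(x, y) \<in> M\<inverse>" "(x, z) \<in> M\<inverse>"
    then have "snd (snd w) y = snd (snd w) z"
      using agreesD[OF agr(1)] by (metis converse_iff)
    then show "y = z" using permutes_inj[OF agr(4)] by (simp add: inj_eq)
  qed
  note sv = agrees_single_valued[OF agr(1)] svM' agrees_single_valued[OF agr(2)] agrees_single_valued[OF agr(3)]
  define m where "m = card M"
  define \<phi> where "\<phi> = card {f \<in> carrier G \<rightarrow>\<^sub>E carrier G. agrees f F}"
  define \<gamma> where "\<gamma> = card {g \<in> carrier G \<rightarrow>\<^sub>E carrier G. agrees g H}"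
  have "?ideal = {f \<in> carrier G \<rightarrow>\<^sub>E carrier G. agrees f F} \<times> {g \<in> carrier G \<rightarrow>\<^sub>E carrier G. agrees g H}
      \<times> {R. R permutes ?S \<and> agrees R M}"
    by auto
  then have "card ?ideal = \<phi> * (\<gamma> * card {R. R permutes ?S \<and> agrees R M})"
    by (simp add: card_cartesian_product \<phi>_def \<gamma>_def)
  also have "\<dots> \<le> \<phi> * (\<gamma> * fact (N ^ 2 - m))"
    using card_permutes_agrees_le[OF finS(1) M] finS(2) by (simp add: m_def)
  finally have "real (card ?ideal) \<le> real (\<phi> * (\<gamma> * fact (N ^ 2 - m)))"
    by (rule of_nat_mono)
  then have ideal: "real (card ?ideal) \<le> \<phi> * \<gamma> * fact (N ^ 2 - m)" by simp
  define bad where "bad = card {w \<in> key_worlds H. \<not> good M F H w}"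
  define ev where "ev = 2 * card M * card H + 2 * card M * card F + 2 * (card M * card M) + 2 * (card M * (card M - 1))"
  have K: "card (key_worlds H) = N * N * \<gamma>"
    by (simp add: key_worlds_def card_cartesian_product N_def \<gamma>_def)
  have "N * bad \<le> ev * (N * N * \<gamma>)"
    using card_bad_le[OF fin M sv(1,2) F H] by (simp add: bad_def ev_def N_def[symmetric] K)
  then have "real N * real bad \<le> real ev * (real N * real N * real \<gamma>)"
    by (metis of_nat_le_iff of_nat_mult)
  then have bad: "real bad \<le> real ev / real N * (real N ^ 2 * \<gamma>)"
    using N by (simp add: field_simps power2_eq_square)
  have fink: "finite (key_worlds H)" by (rule finite_key_worlds[OF fin])
  have "card (key_worlds H) = card {w \<in> key_worlds H. good M F H w} + bad"
  proof -
    have "key_worlds H = {w \<in> key_worlds H. good M F H w} \<union> {w \<in> key_worlds H. \<not> good M F H w}"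
      by blast
    also have "card \<dots> = card {w \<in> key_worlds H. good M F H w} + bad"
      unfolding bad_def using fink by (intro card_Un_disjoint) auto
    finally show ?thesis .
  qed
  then have "real N ^ 2 * \<gamma> = real (card {w \<in> key_worlds H. good M F H w}) + real bad"
    unfolding K by (simp add: power2_eq_square flip: of_nat_add of_nat_mult)
  then have good: "(1 - real ev / N) * (real N ^ 2 * \<gamma>) \<le> real (card {w \<in> key_worlds H. good M F H w})"
    using bad by (simp add: left_diff_distrib)
  have dom: "card F \<le> N"
    using card_Domain_single_valued[OF sv(3)] card_mono[OF fin, of "Domain F"] F by (auto simp: N_def)
  have "real \<phi> = real N ^ (N - card F)"
    using card_funcset_agrees[OF fin F sv(3)] by (simp add: \<phi>_def N_def)
  then have \<phi>: "real \<phi> = real N ^ N / real N ^ card F"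
    using N dom by (simp add: power_diff)
  have "(1 - real ev / N) * (real N ^ 2 * \<gamma>) * (real N ^ N / real N ^ (card F + 2 * m))
     \<le> real (card {w \<in> key_worlds H. good M F H w}) * (real N ^ N / real N ^ (card F + 2 * m))"
    using good by (intro mult_right_mono) auto
  also have "\<dots> \<le> real (card ?real)"
    using card_real_worlds_ge[OF fin M F sv(3), of H] by (simp add: N_def m_def)
  \<comment> \<open>The factor \<open>\<phi>\<close> also occurs in the ideal count; what remains is
    the cost of \<open>2 * m\<close> further values of \<open>f\<close>.\<close>
  also have "real N ^ N / real N ^ (card F + 2 * m) = \<phi> / real (N ^ 2) ^ m"
    by (simp add: \<phi> power_add power_mult)
  finally have real: "(1 - real ev / N) * (real N ^ 2 * \<gamma>) * (\<phi> / real (N ^ 2) ^ m) \<le> real (card ?real)" .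
  \<comment> \<open>\<open>s\<close> bounds the proportion of bad key worlds and \<open>t\<close> is
    the birthday loss of a permutation against independent answers; the two losses combine through
    \<open>1 - s - t \<le> (1 - s) * (1 - t)\<close>.\<close>
  define s t where "s = real ev / N" and "t = real (m choose 2) / real (N ^ 2)"
  have "ev \<le> 2 * q\<^sub>c * q\<^sub>g + 2 * q\<^sub>c * q\<^sub>f + 2 * (q\<^sub>c * q\<^sub>c) + 2 * (q\<^sub>c * (q\<^sub>c - 1))"
    unfolding ev_def using q by (intro add_mono mult_mono diff_le_mono order_refl) auto
  moreover have "m choose 2 \<le> q\<^sub>c choose 2"
    unfolding m_def using q(1) by (rule binomial_right_mono)
  ultimately have "s + t \<le> \<delta>"
    unfolding s_def t_def \<delta>_def by (intro add_mono divide_mono of_nat_mono) (use N in auto)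
  moreover have st: "0 \<le> s" "0 \<le> t" by (auto simp: s_def t_def)
  moreover have "1 - s - t \<le> (1 - s) * (1 - t)"
    using mult_nonneg_nonneg[OF st] by (simp add: algebra_simps)
  ultimately have le: "1 - \<delta> \<le> (1 - s) * (1 - t)" and s1: "s \<le> 1" using \<delta> by linarith+
  have "card M \<le> N ^ 2"
    using card_Domain_single_valued[OF sv(1)] card_mono[OF finS(1), of "Domain M"] finS(2) M by auto
  then have fact: "(1 - t) * (real (N ^ 2) ^ m * fact (N ^ 2 - m)) \<le> fact (N ^ 2)"
    unfolding t_def m_def by (rule power_times_fact_ge)
  have "(1 - \<delta>) * (real (N ^ 2) ^ m * fact (N ^ 2 - m)) \<le> (1 - s) * (1 - t) * (real (N ^ 2) ^ m * fact (N ^ 2 - m))"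
    using le by (intro mult_right_mono) auto
  also have "\<dots> = (1 - s) * ((1 - t) * (real (N ^ 2) ^ m * fact (N ^ 2 - m)))"
    by (rule mult.assoc)
  also have "\<dots> \<le> (1 - s) * fact (N ^ 2)"
    using fact s1 by (intro mult_left_mono) auto
  finally have key: "(1 - \<delta>) * fact (N ^ 2 - m) / fact (N ^ 2) \<le> (1 - s) / real (N ^ 2) ^ m"
    using N by (simp add: field_simps)
  define P where "P = real N ^ N * real N ^ N"
  have P: "P > 0" using N by (simp add: P_def)
  have "(1 - \<delta>) / (P * fact (N ^ 2)) * card ?ideal
      \<le> (1 - \<delta>) / (P * fact (N ^ 2)) * (\<phi> * \<gamma> * fact (N ^ 2 - m))"
    using ideal \<delta> P by (intro mult_left_mono divide_nonneg_nonneg) auto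
  also have "\<dots> = \<phi> * \<gamma> / P * ((1 - \<delta>) * fact (N ^ 2 - m) / fact (N ^ 2))"
    by simp
  also have "\<dots> \<le> \<phi> * \<gamma> / P * ((1 - s) / real (N ^ 2) ^ m)"
    using key P by (intro mult_left_mono) auto
  also have "\<dots> = 1 / (P * real N ^ 2) * ((1 - real ev / N) * (real N ^ 2 * \<gamma>) * (\<phi> / real (N ^ 2) ^ m))"
    using N P by (simp add: s_def field_simps)
  also have "\<dots> \<le> 1 / (P * real N ^ 2) * card ?real"
    using real P by (intro mult_left_mono) auto
  finally show ?thesis unfolding P_def .
qed

end

section \<open>The bound on the advantage\<close>

lemma pmf_bind3_of_set:
  assumes "finite A" "A \<noteq> {}" "finite B" "B \<noteq> {}" "finite C" "C \<noteq> {}"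
  shows "pmf (do {x \<leftarrow> pmf_of_set A; y \<leftarrow> pmf_of_set B; z \<leftarrow> pmf_of_set C; h x y z}) b
    = 1 / (real (card A) * real (card B) * real (card C))
      * (\<Sum>w\<in>A \<times> B \<times> C. pmf (h (fst w) (fst (snd w)) (snd (snd w))) b)"
proof -
  have "(\<Sum>w\<in>A \<times> B \<times> C. pmf (h (fst w) (fst (snd w)) (snd (snd w))) b)
      = (\<Sum>x\<in>A. \<Sum>y\<in>B. \<Sum>z\<in>C. pmf (h x y z) b)"
    by (simp add: sum.cartesian_product case_prod_beta)
  then show ?thesis
    using assms by (simp add: pmf_bind integral_pmf_of_set sum_divide_distrib[symmetric])
qed

theorem theorem31:
  fixes G :: "('a, 'b) monoid_scheme" and A :: "'a adversary" and qc qf qg :: nat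
  assumes "group G" and "finite (carrier G)" and "query_bounded G A qc qf qg"
  shows "\<bar>pmf (real_game G A) True - pmf (ideal_game G A) True\<bar>
    \<le> (2 * real qc ^ 2 + 4 * real qf * real qc + 4 * real qg * real qc + real qc ^ 2 - real qc)
          * inverse (real (order G))
      + 2 * real (qc choose 2) * (2 * inverse (real (order G)) + inverse (real (order G) ^ 2))"
proof -
  interpret group G by fact
  note fin = assms(2)
  define N where "N = card (carrier G)"
  define \<delta> where "\<delta> = real (2 * qc * qg + 2 * qc * qf + 2 * (qc * qc) + 2 * (qc * (qc - 1))) / real N
    + real (qc choose 2) / real N ^ 2"
  let ?Fun = "carrier G \<rightarrow>\<^sub>E carrier G" and ?S = "carrier (G \<times>\<times> G)"
  let ?Perm = "{R. R permutes ?S}"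
  have finS: "finite ?S" "card ?S = N ^ 2" "?S \<noteq> {}"
    using fin by (auto simp: N_def card_cartesian_product power2_eq_square)
  have Fun: "finite ?Fun" "card ?Fun = N ^ N" "?Fun \<noteq> {}"
    using fin by (auto simp: card_PiE N_def PiE_eq_empty_iff intro!: finite_PiE)
  have Perm: "finite ?Perm" "card ?Perm = fact (N ^ 2)" "?Perm \<noteq> {}"
    using finS by (auto simp: finite_permutations card_permutations intro: permutes_id)
  have "carrier G \<noteq> {}" by auto
  then have N: "N \<ge> 1" using fin by (simp add: N_def Suc_leI card_gt_0_iff)
  have ratio: "(1 - \<delta>) * pmf (ideal_game G A) b \<le> pmf (real_game G A) b" for b
  proof -
    let ?W1 = "?Fun \<times> ?Fun \<times> ?S" and ?W2 = "?Fun \<times> ?Fun \<times> ?Perm"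
    let ?P1 = "\<lambda>w. cipher G (fst w) (fst (snd w)) (snd (snd w))"
    let ?P2 = "\<lambda>w. snd (snd w)"
    define c1 c2 where "c1 = 1 / (real N ^ N * real N ^ N * real N ^ 2)"
      and "c2 = (1 - \<delta>) / (real N ^ N * real N ^ N * fact (N ^ 2))"
    \<comment> \<open>At the root the transcript is empty and the budgets are full, so the sums
      range over all worlds and, with their weights, are the output probabilities.\<close>
    have "c2 * (\<Sum>w\<in>{w \<in> ?W2. agrees (?P2 w) {} \<and> agrees (fst w) {} \<and> agrees (fst (snd w)) {}}.
          pmf (run (?P2 w) (inv_into ?S (?P2 w)) (fst w) (fst (snd w)) A) b)
      \<le> c1 * (\<Sum>w\<in>{w \<in> ?W1. agrees (?P1 w) {} \<and> agrees (fst w) {} \<and> agrees (fst (snd w)) {}}.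
          pmf (run (?P1 w) (inv_into ?S (?P1 w)) (fst w) (fst (snd w)) A) b)"
    proof (rule sum_transcript_le[where qc = qc and qf = qf and qg = qg and nc = qc and nf = qf and ng = qg])
      show "c1 \<ge> 0" by (simp add: c1_def)
      show "bij_betw (?P1 w) ?S ?S \<and> fst w \<in> carrier G \<rightarrow> carrier G \<and> fst (snd w) \<in> carrier G \<rightarrow> carrier G"
        if "w \<in> ?W1" for w
      proof -
        have "fst w \<in> carrier G \<rightarrow> carrier G" "fst (snd w) \<in> carrier G \<rightarrow> carrier G" "snd (snd w) \<in> ?S"
          using that unfolding mem_Times_iff PiE_def by blast+
        then show ?thesis
          using bij_betw_cipher by blast
      qed
      show *: "bij_betw (?P2 w) ?S ?S \<and> fst w \<in> carrier G \<rightarrow> carrier G \<and> fst (snd w) \<in> carrier G \<rightarrow> carrier G"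
        if "w \<in> ?W2" for w
        using that permutes_imp_bij unfolding mem_Times_iff PiE_def by blast
      show "run_bounded G (?P2 w) (inv_into ?S (?P2 w)) (fst w) (fst (snd w)) A qc qf qg"
        if "w \<in> {w \<in> ?W2. agrees (?P2 w) {} \<and> agrees (fst w) {} \<and> agrees (fst (snd w)) {}}" for w
        using assms(3) *[of w] that unfolding query_bounded_def by blast
      show "c2 * card {w \<in> ?W2. agrees (?P2 w) M \<and> agrees (fst w) F \<and> agrees (fst (snd w)) H}
        \<le> c1 * card {w \<in> ?W1. agrees (?P1 w) M \<and> agrees (fst w) F \<and> agrees (fst (snd w)) H}"
        if "M \<subseteq> ?S \<times> ?S" "F \<subseteq> carrier G \<times> carrier G" "H \<subseteq> carrier G \<times> carrier G"
          "card M \<le> qc" "card F \<le> qf" "card H \<le> qg" for M F H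
        using transcript_ratio[OF fin that] unfolding c1_def c2_def \<delta>_def N_def .
    qed (use fin finS Fun Perm in auto)
    then have "c2 * (\<Sum>w\<in>?W2. pmf (run (?P2 w) (inv_into ?S (?P2 w)) (fst w) (fst (snd w)) A) b)
      \<le> c1 * (\<Sum>w\<in>?W1. pmf (run (?P1 w) (inv_into ?S (?P1 w)) (fst w) (fst (snd w)) A) b)"
      by simp
    moreover have "pmf (ideal_game G A) b = 1 / (real N ^ N * real N ^ N * fact (N ^ 2))
        * (\<Sum>w\<in>?W2. pmf (run (?P2 w) (inv_into ?S (?P2 w)) (fst w) (fst (snd w)) A) b)"
      unfolding ideal_game_def random_oracle_def
      by (subst pmf_bind3_of_set) (use Fun Perm in auto)
    moreover have "pmf (real_game G A) b
        = c1 * (\<Sum>w\<in>?W1. pmf (run (?P1 w) (inv_into ?S (?P1 w)) (fst w) (fst (snd w)) A) b)"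
      unfolding real_game_def random_oracle_def c1_def
      by (subst pmf_bind3_of_set) (use Fun finS in auto)
    ultimately show ?thesis by (simp add: c2_def)
  qed
  \<comment> \<open>The ratio for the output \<open>False\<close> bounds the real probability of
    \<open>True\<close> from above, the one for \<open>True\<close> bounds it from below.\<close>
  have False_eq: "pmf p False = 1 - pmf p True" for p :: "bool pmf"
    by (simp add: pmf_False_conv_True)
  have \<delta>0: "\<delta> \<ge> 0" by (simp add: \<delta>_def)
  define r i where "r = pmf (real_game G A) True" and "i = pmf (ideal_game G A) True"
  have i: "0 \<le> i" "i \<le> 1" by (auto simp: i_def pmf_le_1)
  have "(1 - \<delta>) * i \<le> r" "(1 - \<delta>) * (1 - i) \<le> 1 - r"
    using ratio[of True] ratio[of False] by (auto simp: r_def i_def False_eq)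
  moreover have "\<delta> * i \<le> \<delta>" "\<delta> * (1 - i) \<le> \<delta>"
    using i \<delta>0 by (auto intro: mult_left_le)
  ultimately have "\<bar>r - i\<bar> \<le> \<delta>"
    by (simp add: abs_le_iff algebra_simps)
  \<comment> \<open>The constant \<open>\<delta>\<close> is at most the claimed one: the quadratic
    terms need only \<open>real qc \<le> real qc ^ 2\<close>, and the terms with \<open>qf\<close>,
    \<open>qg\<close> and \<open>N ^ 2\<close> appear with half the claimed coefficient.\<close>
  also have "\<delta> \<le> (2 * real qc ^ 2 + 4 * real qf * real qc + 4 * real qg * real qc + real qc ^ 2 - real qc)
          * inverse (real N)
      + 2 * real (qc choose 2) * (2 * inverse (real N) + inverse (real N ^ 2))"
  proof -
    have ch: "2 * real (qc choose 2) = real qc ^ 2 - real qc"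
      by (induction qc) (simp_all add: numeral_2_eq_2 algebra_simps)
    have q1: "real (qc * (qc - 1)) = real qc ^ 2 - real qc"
      by (cases qc) (simp_all add: power2_eq_square algebra_simps)
    have "real (2 * qc * qg + 2 * qc * qf + 2 * (qc * qc) + 2 * (qc * (qc - 1)))
        = 2 * real qc * real qg + 2 * real qc * real qf + 2 * real qc ^ 2 + 2 * real (qc * (qc - 1))"
      by (simp add: power2_eq_square)
    also have "\<dots> \<le> 2 * real qc ^ 2 + 4 * real qf * real qc + 4 * real qg * real qc + real qc ^ 2 - real qc
        + 2 * (2 * real (qc choose 2))"
    proof -
      have "0 \<le> real (qc * (qc - 1))" by (rule of_nat_0_le_iff)
      then have sq: "real qc \<le> real qc ^ 2" unfolding q1 by simp
      have "2 * x * z + 2 * x * y + 2 * x ^ 2 + 2 * (x ^ 2 - x)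
          \<le> 2 * x ^ 2 + 4 * y * x + 4 * z * x + x ^ 2 - x + 2 * (x ^ 2 - x)"
        if "x \<le> x ^ 2" "0 \<le> x * y" "0 \<le> x * z" for x y z :: real
        using that by (simp add: algebra_simps)
      from this[OF sq, of "real qf" "real qg"] show ?thesis unfolding q1 ch by simp
    qed
    finally have "real (2 * qc * qg + 2 * qc * qf + 2 * (qc * qc) + 2 * (qc * (qc - 1))) * inverse (real N)
      \<le> (2 * real qc ^ 2 + 4 * real qf * real qc + 4 * real qg * real qc + real qc ^ 2 - real qc
        + 2 * (2 * real (qc choose 2))) * inverse (real N)"
      by (intro mult_right_mono) auto
    moreover have "real (qc choose 2) * inverse (real N ^ 2) \<le> 2 * real (qc choose 2) * inverse (real N ^ 2)"
      by (intro mult_right_mono) auto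
    ultimately have "\<delta> \<le> (2 * real qc ^ 2 + 4 * real qf * real qc + 4 * real qg * real qc + real qc ^ 2 - real qc
        + 2 * (2 * real (qc choose 2))) * inverse (real N)
        + 2 * real (qc choose 2) * inverse (real N ^ 2)"
      unfolding \<delta>_def divide_inverse by (rule add_mono)
    then show ?thesis
      by (simp add: algebra_simps)
  qed
  finally show ?thesis by (simp add: r_def i_def N_def order_def)
qed

end
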